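(* Let $\beta_1,\beta_2\in\mathbb R$, let $A=\begin{pmatrix}\beta_1&0\\0&\beta_2\end{pmatrix}$, and let $H_A$ be the Hilbert space of entire functions $f:\mathbb C^2\to\mathbb C$ with $$\|f\|^2=\int_{\mathbb C^2}|f(z)|^2\exp\left(-\Re(\beta_1z_1^2+\beta_2z_2^2)-|z|^2\right)d\lambda(z)<\infty .$$ For $j=1,2$ let $a_j(f)=\frac{\partial f}{\partial z_j}$ and $b_j(f)=z_jf$ be the densely defined operators on $H_A$ with domains $\mathrm{dom}(a_j)=\{f\in H_A: \partial f/\partial z_j\in H_A\}$ and $\mathrm{dom}(b_j)=\{f\in H_A: z_jf\in H_A\}$, and let $a_j^*,b_j^*$ be their Hilbert space adjoints. Then for $j=1,2$: (1) $\mathrm{dom}(a_j)=\mathrm{dom}(a_j^* )$ and $\|a_j^*(f)\|^2-\|a_j(f)\|^2=(1-\beta_j^2)\|f\|^2$ for all $f\in\mathrm{dom}(a_j)$. (2) $\mathrm{dom}(b_j)=\mathrm{dom}(b_j^* )$ and $\|b_j(f)\|^2-\|b_j^*(f)\|^2=\|f\|^2$ for all $f\in\mathrm{dom}(b_j)$. (3) $a_j^*(f)=\beta_ja_j(f)+(1-\beta_j^2)b_j(f)$ for all $f\in\mathrm{dom}(a_j)\cap\mathrm{dom}(b_j)$. (4) The commutation relations $[a_j,a_j^*]=a_ja_j^*-a_j^*a_j=(1-\beta_j^2)I$ hold, and moreover $[a_j,a_k]=0$ and $[a_j^*,a_k^*]=0$ for $j,k=1,2$. (5) If $\beta_j^2\neq1$,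 then for all $f\in\mathrm{dom}(a_j)$, $$\|f\|^2\le\frac{1}{|1-\beta_j^2|}\left(\|a_j^*(f)\|^2+\|a_j(f)\|^2\right).$$
   Context: $d\lambda$ denotes Lebesgue measure on $\mathbb C^2\cong\mathbb R^4$, $z=(z_1,z_2)$ and $|z|^2=|z_1|^2+|z_2|^2$. The inner product on $H_A$ is $(f,g)=\int_{\mathbb C^2}f(z)\overline{g(z)}\exp(-\Re(\beta_1z_1^2+\beta_2z_2^2)-|z|^2)\,d\lambda(z)$. A commutator $[S,T]=ST-TS$ of unbounded operators is understood on $\mathrm{dom}(ST)\cap\mathrm{dom}(TS)$, where $\mathrm{dom}(ST)=\{f\in\mathrm{dom}(T):Tf\in\mathrm{dom}(S)\}$; e.g. $[S,T]=cI$ means $STf-TSf=cf$ for all $f$ in this set. *)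

theory Defs
  imports "HOL-Complex_Analysis.Complex_Analysis"
begin

type_synonym cfun = "complex ^ 2 \<Rightarrow> complex"

(* Entire on C^2: complex Frechet differentiable everywhere, i.e. the (real) derivative
   exists at every point and is complex linear. *)
definition entire2 :: "cfun \<Rightarrow> bool" where
  "entire2 f \<longleftrightarrow>
     (\<forall>z. \<exists>c :: complex ^ 2. (f has_derivative (\<lambda>h. c $ 1 * h $ 1 + c $ 2 * h $ 2)) (at z))"

definition partial_deriv :: "2 \<Rightarrow> cfun \<Rightarrow> cfun" where
  "partial_deriv j f z = deriv (\<lambda>w. f (z + axis j w)) 0"

(* The diagonal matrix A = diag(b_1, b_2) is represented by the vector of its diagonal entries. *)
definition weight :: "real ^ 2 \<Rightarrow> complex ^ 2 \<Rightarrow> real" where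
  "weight \<beta> z =
     exp (- Re (complex_of_real (\<beta> $ 1) * (z $ 1)\<^sup>2 + complex_of_real (\<beta> $ 2) * (z $ 2)\<^sup>2)
          - ((cmod (z $ 1))\<^sup>2 + (cmod (z $ 2))\<^sup>2))"

definition HA :: "real ^ 2 \<Rightarrow> cfun set" where
  "HA \<beta> = {f. entire2 f \<and> integrable lborel (\<lambda>z. (cmod (f z))\<^sup>2 * weight \<beta> z)}"

definition HA_norm :: "real ^ 2 \<Rightarrow> cfun \<Rightarrow> real" where
  "HA_norm \<beta> f = sqrt (LINT z|lborel. (cmod (f z))\<^sup>2 * weight \<beta> z)"

definition HA_inner :: "real ^ 2 \<Rightarrow> cfun \<Rightarrow> cfun \<Rightarrow> complex" where
  "HA_inner \<beta> f g = (LINT z|lborel. f z * cnj (g z) * complex_of_real (weight \<beta> z))"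

(* An unbounded operator is a partial map T: its domain is dom T, and its value at f in dom T
   is the (T f).  The library composition S \<circ>\<^sub>m T then has exactly the domain
   {f in dom T. T f in dom S} of the product S T. *)
type_synonym unbounded_op = "cfun \<rightharpoonup> cfun"

definition a_op :: "real ^ 2 \<Rightarrow> 2 \<Rightarrow> unbounded_op" where
  "a_op \<beta> j f =
     (if f \<in> HA \<beta> \<and> partial_deriv j f \<in> HA \<beta> then Some (partial_deriv j f) else None)"

definition b_op :: "real ^ 2 \<Rightarrow> 2 \<Rightarrow> unbounded_op" where
  "b_op \<beta> j f =
     (if f \<in> HA \<beta> \<and> (\<lambda>z. z $ j * f z) \<in> HA \<beta> then Some (\<lambda>z. z $ j * f z) else None)"

definition is_adjoint_value :: "real ^ 2 \<Rightarrow> unbounded_op \<Rightarrow> cfun \<Rightarrow> cfun \<Rightarrow> bool" where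
  "is_adjoint_value \<beta> T g h \<longleftrightarrow>
     h \<in> HA \<beta> \<and> (\<forall>f \<in> dom T. HA_inner \<beta> (the (T f)) g = HA_inner \<beta> f h)"

(* The value h is unique, hence the description meaningful, whenever T is densely defined. *)
definition adjoint_op :: "real ^ 2 \<Rightarrow> unbounded_op \<Rightarrow> unbounded_op" where
  "adjoint_op \<beta> T g =
     (if g \<in> HA \<beta> \<and> (\<exists>h. is_adjoint_value \<beta> T g h)
      then Some (THE h. is_adjoint_value \<beta> T g h) else None)"

definition commutator :: "unbounded_op \<Rightarrow> unbounded_op \<Rightarrow> unbounded_op" where
  "commutator S T f =
     (if f \<in> dom (S \<circ>\<^sub>m T) \<inter> dom (T \<circ>\<^sub>m S)
      then Some (\<lambda>z. the ((S \<circ>\<^sub>m T) f) z - the ((T \<circ>\<^sub>m S) f) z) else None)"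

(* The relation [S, T] = c I on dom (S T) \<inter> dom (T S). *)
definition commutator_eq_scalar :: "unbounded_op \<Rightarrow> unbounded_op \<Rightarrow> complex \<Rightarrow> bool" where
  "commutator_eq_scalar S T c \<longleftrightarrow>
     (\<forall>f \<in> dom (commutator S T). the (commutator S T f) = (\<lambda>z. c * f z))"

end

theory Submission
  imports Defs "HOL-Probability.Distributions"
begin

text \<open>
  Multiplication by \<open>exp (- (\<beta>\<^sub>1 z\<^sub>1\<^sup>2 + \<beta>\<^sub>2 z\<^sub>2\<^sup>2) / 2)\<close> is unitary from \<open>H\<^sub>A\<close> onto the Fock space of entire
  functions that are square integrable for the Gaussian measure. With \<open>D\<close> the derivative and \<open>M\<close> the
  multiplication in the \<open>j\<close>-th variable, it turns \<open>a\<^sub>j\<close> into \<open>D + \<beta>\<^sub>j M\<close> and \<open>b\<^sub>j\<close> into \<open>M\<close>. All claims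
  follow from the fact that, for all real \<open>p\<close> and \<open>q\<close>, the operators \<open>p D + q M\<close> and \<open>q D + p M\<close> on their
  maximal domains have the same domain, are adjoint to each other, and satisfy
  \<open>\<parallel>(q D + p M) f\<parallel>\<^sup>2 - \<parallel>(p D + q M) f\<parallel>\<^sup>2 = (p\<^sup>2 - q\<^sup>2) \<parallel>f\<parallel>\<^sup>2\<close>. By Fubini this is a statement about one variable, where
  Parseval's identity reduces it to Taylor coefficients: the partial sums of the two sides telescope up to a
  boundary term at \<open>N\<close> of size \<open>(N + 1) v\<^sub>N\<close> with \<open>v\<close> summable, and such a term is small for
  infinitely many \<open>N\<close> because the harmonic series diverges. Testing against the monomials in both variables
  shows that nothing else is in the domain of the adjoint.
\<close>

text \<open>The obstacle: membership in the domain controls only the combination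
  \<open>p D f + q M f\<close>, not \<open>D f\<close> and \<open>M f\<close> separately, so one
  cannot integrate by parts term by term. Truncated Taylor sums avoid this, because every truncation
  is a finite identity with an explicit boundary term.

  The two-parameter family is chosen because passing to the adjoint just exchanges \<open>p\<close>
  and \<open>q\<close>. With \<open>(p, q)\<close> equal to \<open>(1, \<beta> $ j)\<close> one gets
  \<open>a_op\<close>, with \<open>(0, 1)\<close> one gets \<open>b_op\<close>; their adjoints are
  the pairs \<open>(\<beta> $ j, 1)\<close> and \<open>(1, 0)\<close>.

  The passage to two variables freezes the inactive variable, for almost every value of it. The
  commutators need no analysis beyond the symmetry of mixed partial derivatives: on their domains
  they are pointwise identities between entire functions.\<close>

unbundle no fps_syntax

section \<open>Lebesgue measure on the complex plane\<close>

lemma Complex_measurable [measurable]: "(\<lambda>(x, y). Complex x y) \<in> borel_measurable (lborel \<Otimes>\<^sub>M lborel)"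
  by (simp add: borel_prod[symmetric] borel_measurable_complex_iff split_beta' cong: measurable_cong_sets)

text \<open>Boxes in the plane are products of real intervals, and the volumes of boxes determine
  Lebesgue measure. This gives access to iterated integrals over real and imaginary parts.\<close>

lemma lborel_Complex: "distr (lborel \<Otimes>\<^sub>M lborel) borel (\<lambda>(x, y). Complex x y) = lborel"
proof (rule lborel_eqI[symmetric])
  fix l u :: complex
  assume "\<And>b. b \<in> Basis \<Longrightarrow> l \<bullet> b \<le> u \<bullet> b"
  then have le: "Re l \<le> Re u" "Im l \<le> Im u"
    using \<open>\<And>b. b \<in> Basis \<Longrightarrow> l \<bullet> b \<le> u \<bullet> b\<close>[of 1] \<open>\<And>b. b \<in> Basis \<Longrightarrow> l \<bullet> b \<le> u \<bullet> b\<close>[of \<i>]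
    by (auto simp: Basis_complex_def)
  have "(\<lambda>(x, y). Complex x y) -` box l u \<inter> space (lborel \<Otimes>\<^sub>M lborel) = {Re l<..<Re u} \<times> {Im l<..<Im u}"
    by (auto simp: box_def Basis_complex_def space_pair_measure)
  then have "emeasure (distr (lborel \<Otimes>\<^sub>M lborel) borel (\<lambda>(x, y). Complex x y)) (box l u)
      = emeasure (lborel \<Otimes>\<^sub>M lborel) ({Re l<..<Re u} \<times> {Im l<..<Im u})"
    by (simp add: emeasure_distr)
  also have "\<dots> = ennreal (Re u - Re l) * ennreal (Im u - Im l)"
    using le by (subst lborel.emeasure_pair_measure_Times) auto
  also have "\<dots> = ennreal (\<Prod>b\<in>Basis. (u - l) \<bullet> b)"
    using le by (simp add: Basis_complex_def ennreal_mult)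
  finally show "emeasure (distr (lborel \<Otimes>\<^sub>M lborel) borel (\<lambda>(x, y). Complex x y)) (box l u)
      = ennreal (\<Prod>b\<in>Basis. (u - l) \<bullet> b)" .
qed simp

lemma nn_integral_Complex:
  assumes [measurable]: "f \<in> borel_measurable borel"
  shows "(\<integral>\<^sup>+z. f z \<partial>lborel) = (\<integral>\<^sup>+x. \<integral>\<^sup>+y. f (Complex x y) \<partial>lborel \<partial>lborel)"
proof -
  have "(\<integral>\<^sup>+z. f z \<partial>lborel) = (\<integral>\<^sup>+p. f (case p of (x, y) \<Rightarrow> Complex x y) \<partial>(lborel \<Otimes>\<^sub>M lborel))"
    by (subst lborel_Complex[symmetric], subst nn_integral_distr) auto
  also have "\<dots> = (\<integral>\<^sup>+x. \<integral>\<^sup>+y. f (case (x, y) of (x, y) \<Rightarrow> Complex x y) \<partial>lborel \<partial>lborel)"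
    by (rule lborel.nn_integral_fst[symmetric]) measurable
  finally show ?thesis by simp
qed

lemma nn_integral_lborel_plus:
  fixes c :: "'a::euclidean_space"
  assumes [measurable]: "f \<in> borel_measurable borel"
  shows "(\<integral>\<^sup>+x. f (c + x) \<partial>lborel) = (\<integral>\<^sup>+x. f x \<partial>lborel)"
  by (subst (2) lborel_distr_plus[of c, symmetric], subst nn_integral_distr) auto

lemma nn_integral_shear_Im:
  assumes [measurable]: "f \<in> borel_measurable borel"
  shows "(\<integral>\<^sup>+z. f (Complex (Re z) (s * Re z + Im z)) \<partial>lborel) = (\<integral>\<^sup>+z. f z \<partial>lborel)"
proof -
  have [measurable]: "(\<lambda>z. Complex (Re z) (s * Re z + Im z)) \<in> borel_measurable borel"
    by (subst borel_measurable_complex_iff) auto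
  have [measurable]: "(\<lambda>y. f (Complex x y)) \<in> borel_measurable borel" for x
  proof -
    have "(\<lambda>y. Complex x y) \<in> borel_measurable borel"
      by (subst borel_measurable_complex_iff) auto
    then show ?thesis by measurable
  qed
  show ?thesis
    by (subst (1 2) nn_integral_Complex) (auto simp: nn_integral_lborel_plus[of "\<lambda>y. f (Complex _ y)"])
qed

text \<open>Tonelli with the two real integrals exchanged. Conjugating the vertical shear by this
  reflection yields the horizontal one.\<close>

lemma nn_integral_swap_Re_Im:
  assumes [measurable]: "f \<in> borel_measurable borel"
  shows "(\<integral>\<^sup>+z. f (Complex (Im z) (Re z)) \<partial>lborel) = (\<integral>\<^sup>+z. f z \<partial>lborel)"
proof -
  have [measurable]: "(\<lambda>z. Complex (Im z) (Re z)) \<in> borel_measurable borel"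
    by (subst borel_measurable_complex_iff) auto
  have [measurable]: "(\<lambda>(y,x). f (Complex x y)) \<in> borel_measurable (lborel \<Otimes>\<^sub>M lborel)"
    unfolding split_beta'
    by (rule measurable_compose[OF _ assms])
       (simp add: borel_prod[symmetric] borel_measurable_complex_iff cong: measurable_cong_sets)
  show ?thesis
    by (subst (1 2) nn_integral_Complex) (auto intro!: lborel_pair.Fubini')
qed

lemma nn_integral_shear_Re:
  assumes [measurable]: "f \<in> borel_measurable borel"
  shows "(\<integral>\<^sup>+z. f (Complex (Re z + s * Im z) (Im z)) \<partial>lborel) = (\<integral>\<^sup>+z. f z \<partial>lborel)"
proof -
  have [measurable]: "(\<lambda>z. Complex (Im z) (Re z)) \<in> borel_measurable borel"
    "(\<lambda>z. Complex (Re z + s * Im z) (Im z)) \<in> borel_measurable borel"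
    by (subst borel_measurable_complex_iff, auto)+
  have "(\<integral>\<^sup>+z. f (Complex (Re z + s * Im z) (Im z)) \<partial>lborel)
      = (\<integral>\<^sup>+z. f (Complex (s * Re z + Im z) (Re z)) \<partial>lborel)"
    by (subst nn_integral_swap_Re_Im[symmetric]) (auto simp: add.commute)
  also have "\<dots> = (\<integral>\<^sup>+z. f (Complex (Im z) (Re z)) \<partial>lborel)"
    using nn_integral_shear_Im[of "\<lambda>z. f (Complex (Im z) (Re z))" s] by simp
  also have "\<dots> = (\<integral>\<^sup>+z. f z \<partial>lborel)"
    by (rule nn_integral_swap_Re_Im) simp
  finally show ?thesis .
qed

text \<open>A rotation by an angle outside \<open>\<pi>\<int>\<close> is a product of three shears.\<close>
lemma nn_integral_rotate:
  assumes [measurable]: "f \<in> borel_measurable borel" and c: "cmod c = 1" "Im c \<noteq> 0"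
  shows "(\<integral>\<^sup>+z. f (c * z) \<partial>lborel) = (\<integral>\<^sup>+z. f z \<partial>(lborel :: complex measure))"
proof -
  \<comment> \<open>For \<open>c = cis t\<close> this is \<open>- tan (t / 2)\<close>. The rotation
    by \<open>t\<close> is the horizontal shear by \<open>a\<close>, then the vertical shear by
    \<open>sin t\<close>, then the horizontal shear by \<open>a\<close> again.\<close>
  define a where "a = (Re c - 1) / Im c"
  have m: "(\<lambda>z. Complex (Re z + a * Im z) (Im z)) \<in> borel_measurable borel"
    "(\<lambda>z. Complex (Re z) (Im c * Re z + Im z)) \<in> borel_measurable borel"
    by (subst borel_measurable_complex_iff, auto)+
  note [measurable] = m
  have n: "(Re c)\<^sup>2 + (Im c)\<^sup>2 = 1"
    using c(1) by (simp add: cmod_def)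
  have as: "a * Im c = Re c - 1"
    using c(2) by (simp add: a_def)
  have a2: "a * (1 + Re c) = - Im c"
    using c(2) n by (simp add: a_def field_simps power2_eq_square)
  have a2': "a + a * Re c = - Im c" using a2 by (simp add: algebra_simps)
  define S where "S z = Complex (Re z + a * Im z) (Im z)" for z
  define U where "U z = Complex (Re z) (Im c * Re z + Im z)" for z
  have SU [measurable]: "S \<in> borel_measurable borel" "U \<in> borel_measurable borel"
    using m by (simp_all add: S_def[abs_def] U_def[abs_def])
  have eq: "c * z = S (U (S z))" for z
  proof (rule complex_eqI)
    have "Im c * (a * Im z) = (a * Im c) * Im z" by simp
    then have 1: "Im (U (S z)) = Im c * Re z + Re c * Im z"
      unfolding as by (simp add: U_def S_def algebra_simps)
    show "Im (c * z) = Im (S (U (S z)))"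
      using 1 by (simp add: S_def)
    have "Re (S (U (S z))) = Re z + a * Im z + a * (Im c * Re z + Re c * Im z)"
      unfolding 1[symmetric] by (simp add: S_def U_def)
    also have "\<dots> = Re z + (a * Im c) * Re z + (a + a * Re c) * Im z"
      by (simp add: algebra_simps)
    also have "\<dots> = Re (c * z)"
      unfolding as a2' by (simp add: algebra_simps)
    finally show "Re (c * z) = Re (S (U (S z)))" by simp
  qed
  have "(\<integral>\<^sup>+z. f (c * z) \<partial>lborel) = (\<integral>\<^sup>+z. f (S (U (S z))) \<partial>lborel)"
    by (simp add: eq)
  also have "\<dots> = (\<integral>\<^sup>+z. f (S (U z)) \<partial>lborel)"
    using nn_integral_shear_Re[of "\<lambda>z. f (S (U z))" a] by (simp add: S_def)
  also have "\<dots> = (\<integral>\<^sup>+z. f (S z) \<partial>lborel)"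
    using nn_integral_shear_Im[of "\<lambda>z. f (S z)" "Im c"] by (simp add: U_def)
  also have "\<dots> = (\<integral>\<^sup>+z. f z \<partial>lborel)"
    using nn_integral_shear_Re[of f a] by (simp add: S_def)
  finally show ?thesis .
qed

lemma UNIV_2_eq: "j \<noteq> k \<Longrightarrow> (UNIV :: 2 set) = {j, k}"
  using UNIV_2 by (metis (full_types) exhaust_2 insert_commute)

text \<open>The real basis of \<open>complex ^ 2\<close> is the disjoint union of the images of
  \<open>Basis\<close> under \<open>axis j\<close> and \<open>axis k\<close>, so the volume of a box
  factors. Either coordinate can thus play the role of the distinguished variable.\<close>

lemma lborel_axis_pair:
  assumes jk: "j \<noteq> (k::2)"
  shows "distr (lborel \<Otimes>\<^sub>M lborel) borel (\<lambda>(w, v). axis j w + axis k v :: complex ^ 2) = lborel"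
proof (rule lborel_eqI[symmetric])
  note U = UNIV_2_eq[OF jk]
  have "continuous_on UNIV (\<lambda>(w, v). axis j w + axis k v :: complex ^ 2)"
    unfolding split_beta' axis_def
  proof (intro continuous_intros continuous_on_vec_lambda)
    show "continuous_on UNIV (\<lambda>x. if i = j then fst x else 0)" for i
      by (cases "i = j") (auto intro!: continuous_intros)
    show "continuous_on UNIV (\<lambda>x. if i = k then snd x else 0)" for i
      by (cases "i = k") (auto intro!: continuous_intros)
  qed
  then have [measurable]: "(\<lambda>(w, v). axis j w + axis k v :: complex ^ 2) \<in> borel_measurable (lborel \<Otimes>\<^sub>M lborel)"
    by (simp add: borel_measurable_continuous_onI lborel_prod)
  fix l u :: "complex ^ 2"
  assume "\<And>b. b \<in> Basis \<Longrightarrow> l \<bullet> b \<le> u \<bullet> b"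
  then have le: "l $ i \<bullet> b \<le> u $ i \<bullet> b" if "b \<in> Basis" for b i
    using \<open>\<And>b. b \<in> Basis \<Longrightarrow> l \<bullet> b \<le> u \<bullet> b\<close>[of "axis i b"] that by (simp add: inner_axis)
  have "(\<lambda>(w, v). axis j w + axis k v :: complex ^ 2) -` box l u \<inter> space (lborel \<Otimes>\<^sub>M lborel)
      = box (l $ j) (u $ j) \<times> box (l $ k) (u $ k)"
  proof -
    have "x \<in> box l u \<longleftrightarrow> (\<forall>i\<in>{j, k}. x $ i \<in> box (l $ i) (u $ i))" for x
      unfolding U[symmetric] by (auto simp: box_def Basis_vec_def inner_axis)
    then show ?thesis
      using jk by (auto simp: axis_def space_pair_measure)
  qed
  then have "emeasure (distr (lborel \<Otimes>\<^sub>M lborel) borel (\<lambda>(w, v). axis j w + axis k v)) (box l u)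
      = emeasure (lborel \<Otimes>\<^sub>M lborel) (box (l $ j) (u $ j) \<times> box (l $ k) (u $ k))"
    by (simp add: emeasure_distr)
  also have "\<dots> = ennreal (\<Prod>b\<in>Basis. (u $ j - l $ j) \<bullet> b) * ennreal (\<Prod>b\<in>Basis. (u $ k - l $ k) \<bullet> b)"
    using le by (subst lborel.emeasure_pair_measure_Times) (auto simp: emeasure_lborel_box)
  also have "\<dots> = ennreal ((\<Prod>b\<in>Basis. (u $ j - l $ j) \<bullet> b) * (\<Prod>b\<in>Basis. (u $ k - l $ k) \<bullet> b))"
    using le by (subst ennreal_mult) (auto intro!: prod_nonneg simp: inner_diff_left)
  also have "(\<Prod>b\<in>Basis. (u $ j - l $ j) \<bullet> b) * (\<Prod>b\<in>Basis. (u $ k - l $ k) \<bullet> b)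
      = (\<Prod>b\<in>axis j ` Basis. (u - l) \<bullet> b) * (\<Prod>b\<in>axis k ` Basis. (u - l) \<bullet> b)"
    by (subst (1 2) prod.reindex) (auto simp: inj_on_def axis_eq_axis inner_axis)
  also have "\<dots> = (\<Prod>b\<in>axis j ` Basis \<union> axis k ` Basis. (u - l) \<bullet> b)"
    using jk by (subst prod.union_disjoint) (auto simp: axis_eq_axis)
  also have "axis j ` Basis \<union> axis k ` Basis = (Basis :: (complex ^ 2) set)"
    by (auto simp: Basis_vec_def U)
  finally show "emeasure (distr (lborel \<Otimes>\<^sub>M lborel) borel (\<lambda>(w, v). axis j w + axis k v)) (box l u)
      = ennreal (\<Prod>b\<in>Basis. (u - l) \<bullet> b)" .
qed simp

text \<open>The disc of radius \<open>sqrt a\<close> has area \<open>pi * a\<close>, which is linear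
  in \<open>a\<close>; hence the constant density. This takes the place of polar
  coordinates.\<close>

lemma distr_cmod_square:
  "distr lborel borel (\<lambda>z::complex. (cmod z)\<^sup>2) = density lborel (\<lambda>t. ennreal pi * indicator {0..} t)"
    (is "?M = ?N")
proof (rule measure_eqI_generator_eq_countable)
  let ?LE = "\<lambda>a::real. {..a}" let ?E = "range ?LE"
  show "Int_stable ?E"
    by (auto simp: Int_stable_def)
  show "?E \<subseteq> Pow UNIV" "sets ?M = sigma_sets UNIV ?E" "sets ?N = sigma_sets UNIV ?E"
    by (auto simp: borel_eq_atMost)
  show "?LE`Rats \<subseteq> ?E" "(\<Union>i\<in>Rats. ?LE i) = UNIV" "countable (?LE ` Rats)"
    using Rats_no_top_le by (auto intro: countable_rat)
  have *: "emeasure ?M {..a} = ennreal (pi * max a 0)" for a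
  proof (cases "a \<ge> 0")
    case True
    then have "emeasure ?M {..a} = emeasure lborel (cball (0::complex) (sqrt a))"
    proof -
      have "(cmod z)\<^sup>2 \<le> a \<longleftrightarrow> cmod z \<le> sqrt a" for z
        by (metis abs_norm_cancel real_sqrt_abs real_sqrt_le_iff)
      then show ?thesis
        by (subst emeasure_distr) (auto intro!: arg_cong[where f="emeasure lborel"])
    qed
    also have "\<dots> = ennreal (pi * a)"
      using True by (subst emeasure_cball) (auto simp: eval_unit_ball_vol)
    finally show ?thesis using True by simp
  next
    case False
    then have "(\<lambda>z::complex. (cmod z)\<^sup>2) -` {..a} = {}"
      by (auto simp: not_le) (smt (verit) zero_le_power2)
    then show ?thesis using False
      by (simp add: emeasure_distr)
  qed
  have "emeasure ?N {..a} = ennreal (pi * max a 0)" for a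
  proof -
    have "emeasure ?N {..a} = (\<integral>\<^sup>+t. ennreal pi * indicator {0..a} t \<partial>lborel)"
      by (subst emeasure_density) (auto intro!: nn_integral_cong simp: indicator_def)
    also have "\<dots> = ennreal pi * emeasure lborel {0..a}"
      by (subst nn_integral_cmult_indicator) auto
    also have "emeasure lborel {0..a} = ennreal (max a 0)"
      by (cases "a \<ge> 0") auto
    finally show ?thesis by (simp add: ennreal_mult)
  qed
  with * show "X \<in> ?E \<Longrightarrow> emeasure ?M X = emeasure ?N X" for X
    by auto
  show "a \<in> ?LE`Rats \<Longrightarrow> emeasure ?M a \<noteq> \<infinity>" for a
    using * by auto
qed

section \<open>Parseval's identity for the Gaussian measure\<close>

text \<open>Deliberately unnormalised, with total mass \<open>pi\<close>, so that the transfer from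
  \<open>lborel\<close> introduces no constant. The factor \<open>pi\<close> reappears in Parseval's
  identity instead.\<close>

definition gauss :: "complex measure" where
  "gauss = density lborel (\<lambda>z. ennreal (exp (- (cmod z)\<^sup>2)))"

lemma sets_gauss [measurable_cong, simp]: "sets gauss = sets borel"
  and space_gauss [simp]: "space gauss = UNIV"
  by (simp_all add: gauss_def)

lemma nn_integral_gauss:
  assumes [measurable]: "f \<in> borel_measurable borel"
  shows "(\<integral>\<^sup>+z. f z \<partial>gauss) = (\<integral>\<^sup>+z. ennreal (exp (- (cmod z)\<^sup>2)) * f z \<partial>lborel)"
  unfolding gauss_def by (subst nn_integral_density) auto

text \<open>In the variable \<open>t = (cmod z)\<^sup>2\<close> this is the Gamma integral of
  \<open>t ^ k * exp (- t)\<close>.\<close>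

lemma gauss_moment: "(\<integral>\<^sup>+z. ennreal ((cmod z) ^ (2 * k)) \<partial>gauss) = ennreal (pi * fact k)"
proof -
  have "(\<integral>\<^sup>+z. ennreal ((cmod z) ^ (2 * k)) \<partial>gauss)
      = (\<integral>\<^sup>+z. ennreal (((cmod z)\<^sup>2) ^ k * exp (- (cmod z)\<^sup>2)) \<partial>(lborel::complex measure))"
    by (subst nn_integral_gauss) (auto simp: ennreal_mult[symmetric] power_mult[symmetric] mult.commute)
  also have "\<dots> = (\<integral>\<^sup>+t. ennreal (t ^ k * exp (- t)) \<partial>distr lborel borel (\<lambda>z::complex. (cmod z)\<^sup>2))"
    by (subst nn_integral_distr) auto
  also have "\<dots> = (\<integral>\<^sup>+t. ennreal pi * (ennreal (t ^ k * exp (- t)) * indicator {0..} t) \<partial>lborel)"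
    unfolding distr_cmod_square by (subst nn_integral_density) (auto simp: mult_ac)
  also have "\<dots> = ennreal pi * ennreal (fact k)"
    using nn_intergal_power_times_exp_Ici[of k] by (subst nn_integral_cmult) auto
  finally show ?thesis by (simp add: ennreal_mult)
qed

lemma finite_measure_gauss: "finite_measure gauss"
proof
  have "emeasure gauss (space gauss) = (\<integral>\<^sup>+z. ennreal ((cmod z) ^ (2 * 0)) \<partial>gauss)"
    by simp
  also have "\<dots> = ennreal (pi * fact 0)" by (rule gauss_moment)
  finally show "emeasure gauss (space gauss) \<noteq> \<infinity>" by simp
qed

interpretation gauss: finite_measure gauss by (rule finite_measure_gauss)
interpretation gauss_pair: pair_sigma_finite gauss gauss ..

lemma distr_gauss_rotate:
  assumes c: "cmod c = 1" "Im c \<noteq> 0"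
  shows "distr gauss borel ((*) c) = gauss"
proof (rule measure_eqI)
  fix A assume "A \<in> sets (distr gauss borel ((*) c))"
  then have [measurable]: "A \<in> sets borel" by simp
  have "emeasure (distr gauss borel ((*) c)) A = (\<integral>\<^sup>+z. indicator A z \<partial>distr gauss borel ((*) c))"
    by simp
  also have "\<dots> = (\<integral>\<^sup>+z. indicator A (c * z) \<partial>gauss)"
    by (subst nn_integral_distr) auto
  also have "\<dots> = (\<integral>\<^sup>+z. ennreal (exp (- (cmod (c * z))\<^sup>2)) * indicator A (c * z) \<partial>lborel)"
    by (subst nn_integral_gauss) (auto simp: norm_mult c)
  also have "\<dots> = (\<integral>\<^sup>+z. ennreal (exp (- (cmod z)\<^sup>2)) * indicator A z \<partial>lborel)"
    using nn_integral_rotate[OF _ c, of "\<lambda>z. ennreal (exp (- (cmod z)\<^sup>2)) * indicator A z"] by simp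
  also have "\<dots> = emeasure gauss A"
    by (subst nn_integral_gauss[symmetric]) auto
  finally show "emeasure (distr gauss borel ((*) c)) A = emeasure gauss A" .
qed simp

lemma integrable_gauss_disc:
  fixes f :: "complex \<Rightarrow> complex"
  assumes f: "continuous_on UNIV f"
  shows "integrable gauss (\<lambda>z. indicator (cball 0 R) z *\<^sub>R f z)"
proof -
  have [measurable]: "f \<in> borel_measurable borel"
    using f by (rule borel_measurable_continuous_onI)
  have "compact (f ` cball 0 R)"
    using f by (intro compact_continuous_image continuous_on_subset[OF f]) auto
  then obtain B where B: "\<And>z. z \<in> cball 0 R \<Longrightarrow> norm (f z) \<le> B"
    using compact_imp_bounded bounded_iff by (metis imageI)
  show ?thesis
    by (rule gauss.integrable_const_bound[where B="\<bar>B\<bar>"])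
       (use B in \<open>auto intro!: AE_I2 simp: indicator_def intro: order_trans[OF _ abs_ge_self]\<close>)
qed

text \<open>Disc and measure are rotation invariant, while rotating by \<open>c\<close> multiplies
  the integrand by \<open>c ^ m * cnj (c ^ n)\<close>. As soon as this factor differs from 1, the
  integral must vanish.\<close>

lemma integral_gauss_disc_orthogonal:
  assumes mn: "m \<noteq> n"
  shows "(LINT z|gauss. indicator (cball 0 R) z *\<^sub>R (z ^ m * cnj (z ^ n))) = 0" (is "?I = 0")
proof -
  \<comment> \<open>This angle makes the factor equal to \<open>cis 1\<close>, whatever
    \<open>m\<close> and \<open>n\<close> are. Since \<open>0 < \<bar>t\<bar> \<le> 1 < pi\<close>,
    also \<open>sin t\<close> is nonzero, as the rotation lemma requires.\<close>
  define t where "t = 1 / (real m - real n)"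
  define c where "c = cis t"
  have t: "\<bar>t\<bar> \<le> 1" "t \<noteq> 0"
  proof -
    have "\<bar>real m - real n\<bar> \<ge> 1"
      using mn by linarith
    then show "\<bar>t\<bar> \<le> 1" by (simp add: t_def)
    show "t \<noteq> 0" using mn by (simp add: t_def)
  qed
  have sin_nz: "sin x \<noteq> 0" if "\<bar>x\<bar> \<le> 1" "x \<noteq> 0" for x :: real
  proof -
    have "sin \<bar>x\<bar> > 0"
      using that pi_gt3 by (intro sin_gt_zero) auto
    then show ?thesis by (auto simp: abs_if split: if_splits)
  qed
  have c: "cmod c = 1" "Im c \<noteq> 0"
    using sin_nz t by (auto simp: c_def)
  have "c ^ m * cnj (c ^ n) = cis (real m * t) * cis (- (real n * t))"
    unfolding c_def by (simp only: complex_cnj_power cis_cnj Complex.DeMoivre mult_minus_right)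
  also have "\<dots> = cis ((real m - real n) * t)"
    by (simp add: cis_mult algebra_simps)
  also have "\<dots> = cis 1"
    using mn by (simp add: t_def)
  finally have cmn: "c ^ m * cnj (c ^ n) = cis 1" .
  have "(\<lambda>z. z ^ m * cnj (z ^ n)) \<in> borel_measurable borel"
    by (intro borel_measurable_continuous_onI continuous_intros)
  then have meas: "(\<lambda>z. indicator (cball 0 R) z *\<^sub>R (z ^ m * cnj (z ^ n))) \<in> borel_measurable borel"
    by (intro borel_measurable_scaleR borel_measurable_indicator) auto
  have "?I = (LINT z|distr gauss borel ((*) c). indicator (cball 0 R) z *\<^sub>R (z ^ m * cnj (z ^ n)))"
    by (simp add: distr_gauss_rotate[OF c])
  also have "\<dots> = (LINT z|gauss. indicator (cball 0 R) (c * z) *\<^sub>R ((c * z) ^ m * cnj ((c * z) ^ n)))"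
    using meas by (subst integral_distr) auto
  also have "\<dots> = (LINT z|gauss. cis 1 * (indicator (cball 0 R) z *\<^sub>R (z ^ m * cnj (z ^ n))))"
    unfolding cmn[symmetric]
    by (intro Bochner_Integration.integral_cong) (auto simp: indicator_def norm_mult c power_mult_distrib)
  also have "\<dots> = cis 1 * ?I"
    by (rule integral_mult_right_zero)
  finally have "(1 - cis 1) * ?I = 0"
    by (simp add: algebra_simps)
  moreover have "cis 1 \<noteq> 1"
    using sin_nz[of 1] by (auto simp: complex_eq_iff)
  ultimately show ?thesis by auto
qed

section \<open>Taylor coefficients and Parseval's identity\<close>

definition tcoef :: "(complex \<Rightarrow> complex) \<Rightarrow> nat \<Rightarrow> complex" where
  "tcoef h n = (deriv ^^ n) h 0 / fact n"

lemma tcoef_sums: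
  assumes "h holomorphic_on UNIV"
  shows "(\<lambda>n. tcoef h n * z ^ n) sums h z"
  using holomorphic_power_series[of h 0 "cmod z + 1" z] assms
  unfolding tcoef_def by (auto intro: holomorphic_on_subset)

lemma tcoef_summable:
  assumes "h holomorphic_on UNIV"
  shows "summable (\<lambda>n. cmod (tcoef h n) * R ^ n)"
proof -
  \<comment> \<open>Convergence at a point strictly farther out than \<open>R\<close> gives absolute
    convergence at \<open>R\<close>.\<close>
  have "summable (\<lambda>n. tcoef h n * complex_of_real (\<bar>R\<bar> + 1) ^ n)"
    using tcoef_sums[OF assms] by (rule sums_summable)
  from powser_insidea[OF this, of "of_real R"]
  have "summable (\<lambda>n. norm (tcoef h n * complex_of_real R ^ n))"
    by simp
  then have "summable (\<lambda>n. norm (cmod (tcoef h n) * R ^ n))"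
    by (simp add: norm_mult norm_power abs_mult power_abs)
  then show ?thesis by (rule summable_norm_cancel)
qed

text \<open>On a disc the Taylor polynomials are uniformly bounded, so their orthogonal expansions
  pass to the limit without any integrability of \<open>h\<close> over the plane. The series stays
  under the integral on the right so that both sides are monotone in \<open>R\<close>.\<close>

lemma nn_integral_disc_parseval:
  assumes h: "h holomorphic_on UNIV"
  shows "(\<integral>\<^sup>+z. indicator (cball 0 R) z * ennreal ((cmod (h z))\<^sup>2) \<partial>gauss)
    = (\<integral>\<^sup>+z. indicator (cball 0 R) z * (\<Sum>n. ennreal ((cmod (tcoef h n))\<^sup>2 * cmod z ^ (2 * n))) \<partial>gauss)"
proof -
  define c where "c = tcoef h"
  define D where "D = cball (0::complex) R"
  have [measurable]: "D \<in> sets borel" by (simp add: D_def)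
  have conth: "continuous_on UNIV h"
    using h by (rule holomorphic_on_imp_continuous_on)
  then have [measurable]: "h \<in> borel_measurable borel"
    by (rule borel_measurable_continuous_onI)
  define S where "S N z = (\<Sum>n<N. c n * z ^ n)" for N z
  have contS: "continuous_on UNIV (S N)" for N
    unfolding S_def by (intro continuous_intros)
  then have [measurable]: "S N \<in> borel_measurable borel" for N
    by (rule borel_measurable_continuous_onI)
  define M where "M n = (LINT z|gauss. indicator D z *\<^sub>R (z ^ n * cnj (z ^ n)))" for n
  have orth: "(LINT z|gauss. indicator D z *\<^sub>R (z ^ m * cnj (z ^ n))) = (if m = n then M n else 0)" for m n
    using integral_gauss_disc_orthogonal[of m n R] by (auto simp: M_def D_def)
  have int: "integrable gauss (\<lambda>z. indicator D z *\<^sub>R (z ^ m * cnj (z ^ n)))" for m n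
    unfolding D_def by (intro integrable_gauss_disc continuous_intros)
  have SN: "(LINT z|gauss. indicator D z *\<^sub>R (S N z * cnj (S N z))) = (\<Sum>n<N. c n * cnj (c n) * M n)" for N
  proof -
    have "indicator D z *\<^sub>R (S N z * cnj (S N z))
        = (\<Sum>m<N. \<Sum>n<N. (c m * cnj (c n)) * (indicator D z *\<^sub>R (z ^ m * cnj (z ^ n))))" for z
      unfolding S_def by (cases "z \<in> D") (simp_all add: sum_product mult_ac)
    then have "(LINT z|gauss. indicator D z *\<^sub>R (S N z * cnj (S N z)))
        = (LINT z|gauss. (\<Sum>m<N. \<Sum>n<N. (c m * cnj (c n)) * (indicator D z *\<^sub>R (z ^ m * cnj (z ^ n)))))"
      by (rule Bochner_Integration.integral_cong[OF refl])
    also have "\<dots>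
        = (\<Sum>m<N. \<Sum>n<N. (c m * cnj (c n)) * (LINT z|gauss. indicator D z *\<^sub>R (z ^ m * cnj (z ^ n))))"
      by (subst Bochner_Integration.integral_sum, intro Bochner_Integration.integrable_sum integrable_mult_right int)
         (intro sum.cong refl, subst Bochner_Integration.integral_sum, intro integrable_mult_right int, simp only: integral_mult_right_zero)
    also have "\<dots> = (\<Sum>m<N. c m * cnj (c m) * M m)"
      unfolding orth by (intro sum.cong) (auto simp: if_distrib sum.delta cong: if_cong)
    finally show ?thesis .
  qed
  \<comment> \<open>A bound for all partial sums on the disc at once; \<open>K\<^sup>2\<close> is an
    integrable majorant because \<open>gauss\<close> is finite.\<close>
  define K where "K = (\<Sum>n. cmod (c n) * \<bar>R\<bar> ^ n)"
  have K: "cmod (S N z) \<le> K" if "z \<in> D" for N z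
  proof -
    have "cmod (S N z) \<le> (\<Sum>n<N. cmod (c n) * \<bar>R\<bar> ^ n)"
      unfolding S_def using that
      by (intro order_trans[OF norm_sum] sum_mono)
         (auto simp: D_def norm_mult norm_power intro!: mult_left_mono power_mono)
    also have "\<dots> \<le> K"
      unfolding K_def c_def by (intro sum_le_suminf tcoef_summable h) auto
    finally show ?thesis .
  qed
  have "(\<lambda>N. LINT z|gauss. indicator D z *\<^sub>R (S N z * cnj (S N z)))
      \<longlonglongrightarrow> (LINT z|gauss. indicator D z *\<^sub>R (h z * cnj (h z)))"
  proof (rule integral_dominated_convergence[where w="\<lambda>z. K\<^sup>2"])
    show "AE z in gauss. (\<lambda>N. indicator D z *\<^sub>R (S N z * cnj (S N z)))
        \<longlonglongrightarrow> indicator D z *\<^sub>R (h z * cnj (h z))"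
      using tcoef_sums[OF h] by (intro AE_I2 tendsto_intros) (auto simp: S_def c_def sums_def)
    show "AE z in gauss. norm (indicator D z *\<^sub>R (S N z * cnj (S N z))) \<le> K\<^sup>2" for N
      using K by (intro AE_I2) (auto simp: indicator_def norm_mult power2_eq_square intro!: mult_mono order_trans[OF norm_ge_zero K])
    show "(\<lambda>z. indicator D z *\<^sub>R (h z * cnj (h z))) \<in> borel_measurable gauss"
      unfolding D_def by (intro borel_measurable_integrable integrable_gauss_disc continuous_intros conth)
    show "(\<lambda>z. indicator D z *\<^sub>R (S N z * cnj (S N z))) \<in> borel_measurable gauss" for N
      unfolding D_def by (intro borel_measurable_integrable integrable_gauss_disc continuous_intros contS)
  qed simp
  then have lim: "(\<lambda>n. c n * cnj (c n) * M n) sums (LINT z|gauss. indicator D z *\<^sub>R (h z * cnj (h z)))"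
    unfolding SN sums_def .
  \<comment> \<open>The limit above is an identity between complex numbers. These two facts turn its
    terms and its sum into nonnegative extended reals.\<close>
  have nn: "(\<integral>\<^sup>+z. indicator D z * ennreal ((cmod (g z))\<^sup>2) \<partial>gauss)
      = ennreal (Re (LINT z|gauss. indicator D z *\<^sub>R (g z * cnj (g z))))"
      and ge: "Re (LINT z|gauss. indicator D z *\<^sub>R (g z * cnj (g z))) \<ge> 0"
    if g: "continuous_on UNIV g" for g :: "complex \<Rightarrow> complex"
  proof -
    have i: "integrable gauss (\<lambda>z. indicator D z *\<^sub>R (g z * cnj (g z)))"
      unfolding D_def using g by (intro integrable_gauss_disc continuous_intros)
    have *: "indicator D z *\<^sub>R (g z * cnj (g z)) = complex_of_real (indicator D z * (cmod (g z))\<^sup>2)" for z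
      by (simp add: complex_mult_cnj cmod_power2 indicator_def)
    have i': "integrable gauss (\<lambda>z. indicator D z * (cmod (g z))\<^sup>2)"
      using integrable_Re[OF i] unfolding * by simp
    have eq: "(LINT z|gauss. indicator D z *\<^sub>R (g z * cnj (g z))) = complex_of_real (LINT z|gauss. indicator D z * (cmod (g z))\<^sup>2)"
      unfolding * by (rule integral_complex_of_real)
    show "Re (LINT z|gauss. indicator D z *\<^sub>R (g z * cnj (g z))) \<ge> 0"
      unfolding eq by (auto intro!: integral_nonneg_AE)
    have "(\<integral>\<^sup>+z. indicator D z * ennreal ((cmod (g z))\<^sup>2) \<partial>gauss) = (\<integral>\<^sup>+z. ennreal (indicator D z * (cmod (g z))\<^sup>2) \<partial>gauss)"
      by (intro nn_integral_cong) (auto simp: indicator_def)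
    also have "\<dots> = ennreal (LINT z|gauss. indicator D z * (cmod (g z))\<^sup>2)"
      using i' by (intro nn_integral_eq_integral) auto
    finally show "(\<integral>\<^sup>+z. indicator D z * ennreal ((cmod (g z))\<^sup>2) \<partial>gauss)
      = ennreal (Re (LINT z|gauss. indicator D z *\<^sub>R (g z * cnj (g z))))"
      unfolding eq by simp
  qed
  have cM: "Re (c n * cnj (c n) * M n) = (cmod (c n))\<^sup>2 * Re (M n)" for n
    unfolding complex_norm_square[symmetric] by simp
  have "(\<lambda>n. (cmod (c n))\<^sup>2 * Re (M n)) sums Re (LINT z|gauss. indicator D z *\<^sub>R (h z * cnj (h z)))"
    using sums_Re[OF lim] unfolding cM .
  moreover have M0: "Re (M n) \<ge> 0" for n
    unfolding M_def by (intro ge continuous_intros)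
  ultimately have "(\<integral>\<^sup>+z. indicator D z * ennreal ((cmod (h z))\<^sup>2) \<partial>gauss)
      = (\<Sum>n. ennreal ((cmod (c n))\<^sup>2 * Re (M n)))"
    unfolding nn[OF conth] by (intro suminf_ennreal_eq[symmetric]) auto
  also have "\<dots> = (\<Sum>n. \<integral>\<^sup>+z. indicator D z * ennreal ((cmod (c n))\<^sup>2 * cmod z ^ (2 * n)) \<partial>gauss)"
  proof (intro suminf_cong)
    fix n
    have "ennreal ((cmod (c n))\<^sup>2 * Re (M n)) = ennreal ((cmod (c n))\<^sup>2) * ennreal (Re (M n))"
      using M0 by (simp add: ennreal_mult)
    also have "ennreal (Re (M n)) = (\<integral>\<^sup>+z. indicator D z * ennreal ((cmod (z ^ n))\<^sup>2) \<partial>gauss)"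
      unfolding M_def by (rule nn[symmetric]) (intro continuous_intros)
    also have "ennreal ((cmod (c n))\<^sup>2) * \<dots> = (\<integral>\<^sup>+z. ennreal ((cmod (c n))\<^sup>2) * (indicator D z * ennreal ((cmod (z ^ n))\<^sup>2)) \<partial>gauss)"
      by (rule nn_integral_cmult[symmetric]) simp
    also have "\<dots> = (\<integral>\<^sup>+z. indicator D z * ennreal ((cmod (c n))\<^sup>2 * cmod z ^ (2 * n)) \<partial>gauss)"
      by (intro nn_integral_cong) (simp add: ennreal_mult mult_ac norm_power power_mult[symmetric])
    finally show "ennreal ((cmod (c n))\<^sup>2 * Re (M n)) = (\<integral>\<^sup>+z. indicator D z * ennreal ((cmod (c n))\<^sup>2 * cmod z ^ (2 * n)) \<partial>gauss)" .
  qed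
  also have "\<dots> = (\<integral>\<^sup>+z. (\<Sum>n. indicator D z * ennreal ((cmod (c n))\<^sup>2 * cmod z ^ (2 * n))) \<partial>gauss)"
    by (rule nn_integral_suminf[symmetric]) simp
  finally show ?thesis
    unfolding D_def c_def by simp
qed

text \<open>Monotone convergence in the radius of the disc. Both sides may be infinite, so the
  identity also decides which entire functions are square integrable.\<close>

theorem gauss_parseval:
  assumes h: "h holomorphic_on UNIV"
  shows "(\<integral>\<^sup>+z. ennreal ((cmod (h z))\<^sup>2) \<partial>gauss) = (\<Sum>n. ennreal (pi * fact n * (cmod (tcoef h n))\<^sup>2))"
proof -
  have [measurable]: "h \<in> borel_measurable borel"
    using h by (intro borel_measurable_continuous_onI holomorphic_on_imp_continuous_on)
  have exhaust: "(\<integral>\<^sup>+z. f z \<partial>gauss) = (SUP R. \<integral>\<^sup>+z. indicator (cball 0 (real R)) z * f z \<partial>gauss)"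
    if [measurable]: "f \<in> borel_measurable borel" for f :: "complex \<Rightarrow> ennreal"
  proof -
    have "(SUP R. indicator (cball 0 (real R)) z * f z) = f z" for z :: complex
    proof (rule antisym)
      show "(SUP R. indicator (cball 0 (real R)) z * f z) \<le> f z"
        by (rule SUP_least) (auto simp: indicator_def)
      obtain R where "cmod z \<le> real R" using real_arch_simple by blast
      then have "f z = indicator (cball 0 (real R)) z * f z" by simp
      also have "\<dots> \<le> (SUP R. indicator (cball 0 (real R)) z * f z)"
        by (rule SUP_upper) simp
      finally show "f z \<le> (SUP R. indicator (cball 0 (real R)) z * f z)" .
    qed
    then have "(\<integral>\<^sup>+z. f z \<partial>gauss) = (\<integral>\<^sup>+z. (SUP R. indicator (cball 0 (real R)) z * f z) \<partial>gauss)"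
      by simp
    also have "\<dots> = (SUP R. \<integral>\<^sup>+z. indicator (cball 0 (real R)) z * f z \<partial>gauss)"
      by (rule nn_integral_monotone_convergence_SUP)
         (auto simp: incseq_def le_fun_def indicator_def)
    finally show ?thesis .
  qed
  have m1: "(\<lambda>z. ennreal ((cmod (h z))\<^sup>2)) \<in> borel_measurable borel"
    and m2: "(\<lambda>z. \<Sum>n. ennreal ((cmod (tcoef h n))\<^sup>2 * cmod z ^ (2 * n))) \<in> borel_measurable borel"
    by measurable
  have "(\<integral>\<^sup>+z. ennreal ((cmod (h z))\<^sup>2) \<partial>gauss) = (\<integral>\<^sup>+z. (\<Sum>n. ennreal ((cmod (tcoef h n))\<^sup>2 * cmod z ^ (2 * n))) \<partial>gauss)"
    using nn_integral_disc_parseval[OF h] by (simp only: exhaust[OF m1] exhaust[OF m2])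
  also have "\<dots> = (\<Sum>n. \<integral>\<^sup>+z. ennreal ((cmod (tcoef h n))\<^sup>2 * cmod z ^ (2 * n)) \<partial>gauss)"
    by (rule nn_integral_suminf) simp
  also have "\<dots> = (\<Sum>n. ennreal (pi * fact n * (cmod (tcoef h n))\<^sup>2))"
  proof (intro suminf_cong)
    fix n
    have "(\<integral>\<^sup>+z. ennreal ((cmod (tcoef h n))\<^sup>2 * cmod z ^ (2 * n)) \<partial>gauss)
        = (\<integral>\<^sup>+z. ennreal ((cmod (tcoef h n))\<^sup>2) * ennreal (cmod z ^ (2 * n)) \<partial>gauss)"
      by (simp add: ennreal_mult)
    also have "\<dots> = ennreal ((cmod (tcoef h n))\<^sup>2) * ennreal (pi * fact n)"
      by (subst nn_integral_cmult) (auto simp: gauss_moment)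
    finally show "(\<integral>\<^sup>+z. ennreal ((cmod (tcoef h n))\<^sup>2 * cmod z ^ (2 * n)) \<partial>gauss) = ennreal (pi * fact n * (cmod (tcoef h n))\<^sup>2)"
      by (simp add: ennreal_mult[symmetric] mult_ac)
  qed
  finally show ?thesis .
qed

section \<open>Ladder operators in one variable\<close>

text \<open>One cannot ask for smallness at all large \<open>N\<close>: a \<open>v\<close> supported
  on the powers of 2 with value \<open>1 / (N + 1)\<close> there is summable, yet
  \<open>(N + 1) * v N\<close> returns to 1 infinitely often.\<close>

lemma summable_frequently_small:
  fixes v :: "nat \<Rightarrow> real"
  assumes v: "summable v" "\<And>n. v n \<ge> 0" and e: "e > 0"
  shows "\<exists>N\<ge>M. (real N + 1) * v N < e"
proof (rule ccontr)
  assume "\<not> ?thesis"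
  then have *: "e \<le> (real N + 1) * v N" if "N \<ge> M" for N
    using that by (auto simp: not_less)
  have "summable (\<lambda>n. e * inverse (real (Suc n)))"
  proof (rule summable_comparison_test')
    show "norm (e * inverse (real (Suc n))) \<le> v n" if "n \<ge> M" for n
      using *[OF that] e by (simp add: field_simps)
  qed (rule v)
  then have "summable (\<lambda>n. inverse e * (e * inverse (real (Suc n))))"
    by (rule summable_mult)
  then have "summable (\<lambda>n. inverse (real (Suc n)))"
    using e by (simp add: mult.assoc[symmetric])
  then have "summable (\<lambda>n. inverse (real n))"
    by (subst (asm) summable_Suc_iff)
  then show False
    using not_summable_harmonic[where ?'a = real] by simp
qed

text \<open>Since \<open>g\<close> is already known to converge, smallness along a subsequence is
  enough to identify the limit.\<close>

lemma limit_zero_of_boundary: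
  fixes v :: "nat \<Rightarrow> real" and g :: "nat \<Rightarrow> 'a::real_normed_vector"
  assumes v: "summable v" "\<And>n. v n \<ge> 0"
    and g: "g \<longlonglongrightarrow> L" and le: "\<And>N. norm (g N) \<le> k * ((real N + 1) * v N)"
  shows "L = 0"
proof (rule ccontr)
  assume "L \<noteq> 0"
  then have L: "norm L / 2 < norm L" "norm L > 0" by auto
  from order_tendstoD(1)[OF tendsto_norm[OF g] L(1)] obtain M where
    M: "norm L / 2 < norm (g N)" if "N \<ge> M" for N
    by (auto simp: eventually_sequentially)
  \<comment> \<open>The denominator uses \<open>\<bar>k\<bar> + 1\<close> because \<open>k\<close>
    may be zero or negative.\<close>
  obtain N where N: "N \<ge> M" "(real N + 1) * v N < norm L / (2 * (\<bar>k\<bar> + 1))"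
    using summable_frequently_small[OF v, of "norm L / (2 * (\<bar>k\<bar> + 1))" M] L by auto
  have "norm L / 2 < k * ((real N + 1) * v N)"
    using M[OF N(1)] le[of N] by simp
  also have "\<dots> \<le> (\<bar>k\<bar> + 1) * ((real N + 1) * v N)"
    using v(2) by (intro mult_right_mono) auto
  also have "\<dots> \<le> (\<bar>k\<bar> + 1) * (norm L / (2 * (\<bar>k\<bar> + 1)))"
    using N(2) by (intro mult_left_mono) auto
  also have "\<dots> = norm L / 2"
    by (simp add: field_simps)
  finally show False by simp
qed

text \<open>The effect of \<open>p D + q M\<close> on Taylor coefficients: differentiation shifts
  them down with a factor, multiplication shifts them up and leaves 0 in the first place.\<close>

definition ladder_seq :: "real \<Rightarrow> real \<Rightarrow> (nat \<Rightarrow> complex) \<Rightarrow> nat \<Rightarrow> complex" where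
  "ladder_seq p q c n = of_real p * (of_nat (Suc n) * c (Suc n))
     + of_real q * (case n of 0 \<Rightarrow> 0 | Suc m \<Rightarrow> c m)"

text \<open>Up to the factor \<open>\<pi>\<close>, the weight \<open>n!\<close> is the squared norm of \<open>z\<^sup>n\<close> in the Fock space.\<close>
definition wsq :: "(nat \<Rightarrow> complex) \<Rightarrow> nat \<Rightarrow> real" where
  "wsq c n = fact n * (cmod (c n))\<^sup>2"

lemma wsq_nonneg [simp]: "wsq c n \<ge> 0"
  by (simp add: wsq_def)

text \<open>Both squares have the same cross term \<open>2 * p * q * Re (a * cnj b)\<close>, which
  cancels. Only therefore can the norms be compared without control of the two summands
  separately.\<close>

lemma cmod_swap_combination:
  "(cmod (of_real q * b + of_real p * a))\<^sup>2 - (cmod (of_real p * b + of_real q * a))\<^sup>2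
    = (p\<^sup>2 - q\<^sup>2) * ((cmod a)\<^sup>2 - (cmod b)\<^sup>2)"
  unfolding cmod_power2 by (simp add: power2_eq_square algebra_simps)

text \<open>With the weight \<open>fact n\<close>, the upward shift contributes
  \<open>n * wsq c (n - 1)\<close> and the downward shift \<open>(n + 1) * wsq c (n + 1)\<close>.
  Summed over \<open>n\<close>, consecutive terms differ by exactly one copy of
  \<open>wsq c n\<close>, up to the terms at the cut.\<close>

lemma wsq_ladder_telescope:
  "(\<Sum>n\<le>N. wsq (ladder_seq q p c) n - wsq (ladder_seq p q c) n)
    = (p\<^sup>2 - q\<^sup>2) * ((\<Sum>n\<le>N. wsq c n) - (real N + 1) * (wsq c N + wsq c (Suc N)))"
proof -
  have up: "fact n * (cmod (of_nat (Suc n) * c (Suc n)))\<^sup>2 = (real n + 1) * wsq c (Suc n)" for n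
    by (simp add: wsq_def norm_mult power_mult_distrib power2_eq_square algebra_simps flip: of_nat_Suc)
  \<comment> \<open>At \<open>n = 0\<close> the truncated \<open>n - 1\<close> is harmless, being
    multiplied by \<open>real n\<close>.\<close>
  have *: "wsq (ladder_seq q p c) n - wsq (ladder_seq p q c) n
      = (p\<^sup>2 - q\<^sup>2) * (real n * wsq c (n - 1) - (real n + 1) * wsq c (Suc n))" for n
  proof -
    define a where "a = (case n of 0 \<Rightarrow> 0 | Suc m \<Rightarrow> c m)"
    define b where "b = of_nat (Suc n) * c (Suc n)"
    have "fact n * (cmod a)\<^sup>2 = real n * wsq c (n - 1)"
      by (cases n) (auto simp: a_def wsq_def)
    moreover have "fact n * (cmod b)\<^sup>2 = (real n + 1) * wsq c (Suc n)"
      unfolding b_def by (rule up)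
    moreover have "wsq (ladder_seq q p c) n - wsq (ladder_seq p q c) n
        = fact n * ((cmod (of_real q * b + of_real p * a))\<^sup>2 - (cmod (of_real p * b + of_real q * a))\<^sup>2)"
      by (simp add: wsq_def ladder_seq_def a_def b_def algebra_simps)
    moreover have "fact n * ((p\<^sup>2 - q\<^sup>2) * ((cmod a)\<^sup>2 - (cmod b)\<^sup>2))
        = (p\<^sup>2 - q\<^sup>2) * (fact n * (cmod a)\<^sup>2 - fact n * (cmod b)\<^sup>2)"
      by (simp only: right_diff_distrib mult.left_commute)
    ultimately show ?thesis
      unfolding cmod_swap_combination by simp
  qed
  have "(\<Sum>n\<le>N. real n * wsq c (n - 1) - (real n + 1) * wsq c (Suc n))
      = (\<Sum>n\<le>N. wsq c n) - (real N + 1) * (wsq c N + wsq c (Suc N))"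
    by (induction N) (auto simp: algebra_simps)
  then show ?thesis
    unfolding * sum_distrib_left[symmetric] by simp
qed

text \<open>Before summability of the swapped sequence is known, the boundary term need not have a
  limit. But partial sums of nonnegative terms increase, so it suffices to bound them at arbitrarily
  late \<open>N\<close> with \<open>(N + 1) * v N < 1\<close>.\<close>

lemma wsq_ladder_swap:
  assumes u: "summable (wsq c)" and t: "summable (wsq (ladder_seq p q c))"
  shows "summable (wsq (ladder_seq q p c))"
    and "suminf (wsq (ladder_seq q p c)) + q\<^sup>2 * suminf (wsq c)
       = suminf (wsq (ladder_seq p q c)) + p\<^sup>2 * suminf (wsq c)"
proof -
  define v where "v n = wsq c n + wsq c (Suc n)" for n
  have v: "summable v" "\<And>n. v n \<ge> 0"
    unfolding v_def using u by (auto intro: summable_add simp: summable_Suc_iff)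
  have eq: "(\<Sum>n\<le>N. wsq (ladder_seq q p c) n)
     = (\<Sum>n\<le>N. wsq (ladder_seq p q c) n) + (p\<^sup>2 - q\<^sup>2) * (\<Sum>n\<le>N. wsq c n)
       - (p\<^sup>2 - q\<^sup>2) * ((real N + 1) * v N)" for N
    using wsq_ladder_telescope[of q p c N] by (simp add: sum_subtractf v_def algebra_simps)
  show t': "summable (wsq (ladder_seq q p c))"
  proof (rule bounded_imp_summable)
    fix M
    obtain N where N: "N \<ge> M" "(real N + 1) * v N < 1"
      using summable_frequently_small[OF v, of 1 M] by auto
    have "(\<Sum>n\<le>M. wsq (ladder_seq q p c) n) \<le> (\<Sum>n\<le>N. wsq (ladder_seq q p c) n)"
      using N by (intro sum_mono2) auto
    also have "\<dots> \<le> (\<Sum>n\<le>N. wsq (ladder_seq p q c) n) + \<bar>p\<^sup>2 - q\<^sup>2\<bar> * (\<Sum>n\<le>N. wsq c n) + \<bar>p\<^sup>2 - q\<^sup>2\<bar> * 1"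
    proof -
      have "(p\<^sup>2 - q\<^sup>2) * (\<Sum>n\<le>N. wsq c n) \<le> \<bar>p\<^sup>2 - q\<^sup>2\<bar> * (\<Sum>n\<le>N. wsq c n)"
        by (intro mult_right_mono sum_nonneg) auto
      moreover have "- ((p\<^sup>2 - q\<^sup>2) * ((real N + 1) * v N)) \<le> \<bar>p\<^sup>2 - q\<^sup>2\<bar> * ((real N + 1) * v N)"
        using v(2) by (subst minus_mult_left) (intro mult_right_mono, auto)
      moreover have "\<dots> \<le> \<bar>p\<^sup>2 - q\<^sup>2\<bar> * 1"
        using N by (intro mult_left_mono) auto
      ultimately show ?thesis
        unfolding eq by linarith
    qed
    also have "\<dots> \<le> suminf (wsq (ladder_seq p q c)) + \<bar>p\<^sup>2 - q\<^sup>2\<bar> * suminf (wsq c) + \<bar>p\<^sup>2 - q\<^sup>2\<bar> * 1"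
      by (intro add_mono mult_left_mono sum_le_suminf u t) auto
    finally show "(\<Sum>n\<le>M. wsq (ladder_seq q p c) n) \<le> \<dots>" .
  qed simp
  have lim: "(\<lambda>N. \<Sum>n\<le>N. f n) \<longlonglongrightarrow> suminf f" if "summable f" for f :: "nat \<Rightarrow> real"
    using summable_LIMSEQ'[OF that] .
  \<comment> \<open>Now every series involved converges, hence so does the boundary term, and its
    limit can only be 0.\<close>
  have "(\<lambda>N. (\<Sum>n\<le>N. wsq (ladder_seq p q c) n) + (p\<^sup>2 - q\<^sup>2) * (\<Sum>n\<le>N. wsq c n) - (\<Sum>n\<le>N. wsq (ladder_seq q p c) n))
      \<longlonglongrightarrow> suminf (wsq (ladder_seq p q c)) + (p\<^sup>2 - q\<^sup>2) * suminf (wsq c) - suminf (wsq (ladder_seq q p c))"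
    by (intro tendsto_intros lim u t t')
  then have "(\<lambda>N. (p\<^sup>2 - q\<^sup>2) * ((real N + 1) * v N))
      \<longlonglongrightarrow> suminf (wsq (ladder_seq p q c)) + (p\<^sup>2 - q\<^sup>2) * suminf (wsq c) - suminf (wsq (ladder_seq q p c))"
    unfolding eq by simp
  from limit_zero_of_boundary[OF v this, of "\<bar>p\<^sup>2 - q\<^sup>2\<bar>"] v(2)
  have "suminf (wsq (ladder_seq p q c)) + (p\<^sup>2 - q\<^sup>2) * suminf (wsq c) - suminf (wsq (ladder_seq q p c)) = 0"
    by (simp add: abs_mult)
  then show "suminf (wsq (ladder_seq q p c)) + q\<^sup>2 * suminf (wsq c)
       = suminf (wsq (ladder_seq p q c)) + p\<^sup>2 * suminf (wsq c)"
    by (simp add: algebra_simps)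
qed

text \<open>For the weighted pairing the two shifts are formally adjoint, so only the products that
  link the indices \<open>N\<close> and \<open>N + 1\<close> across the cut survive.\<close>

lemma ladder_seq_pairing_telescope:
  "(\<Sum>n\<le>N. fact n * ladder_seq p q c n * cnj (d n) - fact n * c n * cnj (ladder_seq q p d n))
    = fact (Suc N) * (of_real p * (c (Suc N) * cnj (d N)) - of_real q * (c N * cnj (d (Suc N))))"
proof (induction N)
  case (Suc N)
  then show ?case
    by (simp add: ladder_seq_def) (simp add: algebra_simps)
qed (simp add: ladder_seq_def algebra_simps)

lemma ladder_seq_adjoint:
  assumes c: "summable (wsq c)" and d: "summable (wsq d)"
    and S: "(\<lambda>n. fact n * ladder_seq p q c n * cnj (d n)) sums S"
    and S': "(\<lambda>n. fact n * c n * cnj (ladder_seq q p d n)) sums S'"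
  shows "S = S'"
proof -
  define v where "v n = wsq c n + wsq c (Suc n) + (wsq d n + wsq d (Suc n))" for n
  have v: "summable v" "\<And>n. v n \<ge> 0"
    unfolding v_def using c d by (auto intro!: summable_add simp: summable_Suc_iff)
  \<comment> \<open>The inequality of arithmetic and geometric means, with
    \<open>fact (Suc N)\<close> split as \<open>(N + 1) * fact N\<close>: this leaves one factor
    \<open>N + 1\<close> times summable quantities, the shape required of a boundary term.\<close>
  have prod_le: "fact (Suc N) * (cmod x * cmod y) \<le> (real N + 1) * (fact N * (cmod x)\<^sup>2 + fact N * (cmod y)\<^sup>2)" for N x y
  proof -
    have "2 * (cmod x * cmod y) \<le> (cmod x)\<^sup>2 + (cmod y)\<^sup>2"
      using sum_squares_bound[of "cmod x" "cmod y"] by (simp add: mult.assoc)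
    then have "cmod x * cmod y \<le> (cmod x)\<^sup>2 + (cmod y)\<^sup>2"
      using zero_le_power2[of "cmod x"] zero_le_power2[of "cmod y"] by linarith
    then have "fact (Suc N) * (cmod x * cmod y) \<le> fact (Suc N) * ((cmod x)\<^sup>2 + (cmod y)\<^sup>2)"
      by (intro mult_left_mono) auto
    then show ?thesis
      by (simp add: algebra_simps)
  qed
  have fact_le: "fact N * (cmod (x (Suc N)))\<^sup>2 \<le> wsq x (Suc N)" for x N
    unfolding wsq_def by (intro mult_right_mono fact_mono) auto
  have bound: "norm (\<Sum>n\<le>N. fact n * ladder_seq p q c n * cnj (d n) - fact n * c n * cnj (ladder_seq q p d n))
      \<le> (\<bar>p\<bar> + \<bar>q\<bar>) * ((real N + 1) * v N)" for N
  proof -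
    have cd: "fact (Suc N) * (cmod (c (Suc N)) * cmod (d N)) \<le> (real N + 1) * v N"
    proof (rule order_trans[OF prod_le], rule mult_left_mono)
      show "fact N * (cmod (c (Suc N)))\<^sup>2 + fact N * (cmod (d N))\<^sup>2 \<le> v N"
        using fact_le[of N c] wsq_nonneg[of c N] wsq_nonneg[of d N] wsq_nonneg[of d "Suc N"]
        unfolding v_def wsq_def[of d N, symmetric] by linarith
    qed simp
    have dc: "fact (Suc N) * (cmod (c N) * cmod (d (Suc N))) \<le> (real N + 1) * v N"
    proof (rule order_trans[OF prod_le], rule mult_left_mono)
      show "fact N * (cmod (c N))\<^sup>2 + fact N * (cmod (d (Suc N)))\<^sup>2 \<le> v N"
        using fact_le[of N d] wsq_nonneg[of c N] wsq_nonneg[of d N] wsq_nonneg[of c "Suc N"]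
        unfolding v_def wsq_def[of c N, symmetric] by linarith
    qed simp
    have "norm (fact (Suc N) * (of_real p * (c (Suc N) * cnj (d N)) - of_real q * (c N * cnj (d (Suc N)))))
        \<le> fact (Suc N) * (\<bar>p\<bar> * (cmod (c (Suc N)) * cmod (d N)) + \<bar>q\<bar> * (cmod (c N) * cmod (d (Suc N))))"
      unfolding norm_mult norm_fact
      by (intro mult_left_mono order_trans[OF norm_triangle_ineq4]) (auto simp: norm_mult)
    also have "\<dots> = \<bar>p\<bar> * (fact (Suc N) * (cmod (c (Suc N)) * cmod (d N))) + \<bar>q\<bar> * (fact (Suc N) * (cmod (c N) * cmod (d (Suc N))))"
      by (simp add: algebra_simps)
    also have "\<dots> \<le> \<bar>p\<bar> * ((real N + 1) * v N) + \<bar>q\<bar> * ((real N + 1) * v N)"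
      using cd dc by (intro add_mono mult_left_mono) auto
    finally show ?thesis
      unfolding ladder_seq_pairing_telescope by (simp add: algebra_simps)
  qed
  have "(\<lambda>n. fact n * ladder_seq p q c n * cnj (d n) - fact n * c n * cnj (ladder_seq q p d n)) sums (S - S')"
    by (rule sums_diff[OF S S'])
  then have "(\<lambda>N. \<Sum>n\<le>N. fact n * ladder_seq p q c n * cnj (d n) - fact n * c n * cnj (ladder_seq q p d n)) \<longlonglongrightarrow> S - S'"
    by (simp add: sums_def_le)
  from limit_zero_of_boundary[OF v this bound] show ?thesis by simp
qed

section \<open>From coefficient sequences back to entire functions\<close>

definition ladder :: "real \<Rightarrow> real \<Rightarrow> (complex \<Rightarrow> complex) \<Rightarrow> complex \<Rightarrow> complex" where
  "ladder p q h z = of_real p * deriv h z + of_real q * (z * h z)"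

lemma ladder_holomorphic:
  "h holomorphic_on UNIV \<Longrightarrow> ladder p q h holomorphic_on UNIV"
  unfolding ladder_def[abs_def] by (intro holomorphic_intros) auto

lemma tcoef_add:
  assumes "h holomorphic_on UNIV" "g holomorphic_on UNIV"
  shows "tcoef (\<lambda>z. h z + g z) n = tcoef h n + tcoef g n"
  using higher_deriv_add[OF assms] by (simp add: tcoef_def add_divide_distrib)

lemma tcoef_cmult:
  assumes "h holomorphic_on UNIV"
  shows "tcoef (\<lambda>z. c * h z) n = c * tcoef h n"
  using higher_deriv_cmult[OF assms] by (simp add: tcoef_def)

lemma tcoef_deriv: "tcoef (deriv h) n = of_nat (Suc n) * tcoef h (Suc n)"
  by (simp add: tcoef_def funpow_swap1 del: of_nat_Suc)

lemma tcoef_mult_ident: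
  assumes "h holomorphic_on UNIV"
  shows "tcoef (\<lambda>z. z * h z) n = (case n of 0 \<Rightarrow> 0 | Suc m \<Rightarrow> tcoef h m)"
proof (cases n)
  case (Suc m)
  have "(deriv ^^ n) (\<lambda>z. z * h z) 0
      = (\<Sum>i = 0..n. of_nat (n choose i) * (deriv ^^ i) (\<lambda>w. w) 0 * (deriv ^^ (n - i)) h 0)"
    by (rule higher_deriv_mult[OF _ assms]) auto
  \<comment> \<open>At 0 the identity function has a nonzero derivative of order 1 only.\<close>
  also have "\<dots> = (\<Sum>i\<in>{1}. of_nat (n choose i) * (deriv ^^ i) (\<lambda>w. w) 0 * (deriv ^^ (n - i)) h 0)"
    using Suc by (intro sum.mono_neutral_right) auto
  also have "\<dots> = of_nat n * (deriv ^^ m) h 0"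
    using Suc by simp
  finally show ?thesis
    using Suc by (simp add: tcoef_def del: of_nat_Suc)
qed (simp add: tcoef_def)

lemma tcoef_ladder:
  assumes h: "h holomorphic_on UNIV"
  shows "tcoef (ladder p q h) = ladder_seq p q (tcoef h)"
proof
  fix n
  have "deriv h holomorphic_on UNIV" "(\<lambda>z. z * h z) holomorphic_on UNIV"
    using h by (auto intro!: holomorphic_intros)
  then show "tcoef (ladder p q h) n = ladder_seq p q (tcoef h) n"
    unfolding ladder_def[abs_def]
    by (subst tcoef_add) (auto intro!: holomorphic_intros simp: tcoef_cmult tcoef_deriv tcoef_mult_ident[OF h] ladder_seq_def)
qed

lemma tcoef_monomial: "tcoef (\<lambda>z. z ^ k) n = (if n = k then 1 else 0)"
proof (induction k arbitrary: n)
  case (Suc k)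
  have "tcoef (\<lambda>z. z ^ Suc k) n = (case n of 0 \<Rightarrow> 0 | Suc m \<Rightarrow> tcoef (\<lambda>z. z ^ k) m)"
    unfolding power_Suc by (rule tcoef_mult_ident) (intro holomorphic_intros)
  with Suc show ?case by (auto split: nat.splits)
qed (auto simp: tcoef_def)

lemma gauss_norm_wsq:
  assumes "h holomorphic_on UNIV"
  shows "(\<integral>\<^sup>+z. ennreal ((cmod (h z))\<^sup>2) \<partial>gauss) < \<infinity> \<longleftrightarrow> summable (wsq (tcoef h))"
    and "summable (wsq (tcoef h)) \<Longrightarrow>
      (\<integral>\<^sup>+z. ennreal ((cmod (h z))\<^sup>2) \<partial>gauss) = ennreal (pi * suminf (wsq (tcoef h)))"
proof -
  have eq: "(\<integral>\<^sup>+z. ennreal ((cmod (h z))\<^sup>2) \<partial>gauss) = (\<Sum>n. ennreal (pi * wsq (tcoef h) n))"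
    using gauss_parseval[OF assms] by (simp add: wsq_def mult.assoc)
  show 2: "(\<integral>\<^sup>+z. ennreal ((cmod (h z))\<^sup>2) \<partial>gauss) = ennreal (pi * suminf (wsq (tcoef h)))"
    if "summable (wsq (tcoef h))"
    unfolding eq using that by (subst suminf_ennreal2) (auto intro: summable_mult simp: suminf_mult)
  show "(\<integral>\<^sup>+z. ennreal ((cmod (h z))\<^sup>2) \<partial>gauss) < \<infinity> \<longleftrightarrow> summable (wsq (tcoef h))"
  proof
    assume "(\<integral>\<^sup>+z. ennreal ((cmod (h z))\<^sup>2) \<partial>gauss) < \<infinity>"
    then have "summable (\<lambda>n. pi * wsq (tcoef h) n)"
      unfolding eq by (intro summable_suminf_not_top) auto
    then show "summable (wsq (tcoef h))"
      using summable_mult_D[of pi "wsq (tcoef h)"] by simp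
  qed (simp add: 2)
qed

text \<open>The identity is arranged with sums on both sides because subtraction of extended
  nonnegative reals would lose information; in this form it can be integrated over a further
  variable.\<close>

theorem gauss_ladder_swap:
  assumes h: "h holomorphic_on UNIV"
    and "(\<integral>\<^sup>+z. ennreal ((cmod (h z))\<^sup>2) \<partial>gauss) < \<infinity>"
    and "(\<integral>\<^sup>+z. ennreal ((cmod (ladder p q h z))\<^sup>2) \<partial>gauss) < \<infinity>"
  shows "(\<integral>\<^sup>+z. ennreal ((cmod (ladder q p h z))\<^sup>2) \<partial>gauss) + ennreal (q\<^sup>2) * (\<integral>\<^sup>+z. ennreal ((cmod (h z))\<^sup>2) \<partial>gauss)
       = (\<integral>\<^sup>+z. ennreal ((cmod (ladder p q h z))\<^sup>2) \<partial>gauss) + ennreal (p\<^sup>2) * (\<integral>\<^sup>+z. ennreal ((cmod (h z))\<^sup>2) \<partial>gauss)"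
proof -
  have 1: "summable (wsq (tcoef h))"
    using assms(2) by (simp only: gauss_norm_wsq(1)[OF h])
  have 2: "summable (wsq (ladder_seq p q (tcoef h)))"
    using assms(3) unfolding gauss_norm_wsq(1)[OF ladder_holomorphic[OF h]] tcoef_ladder[OF h] .
  note 3 = wsq_ladder_swap[OF 1 2]
  have nn: "suminf (wsq c) \<ge> 0" if "summable (wsq c)" for c
    using that by (intro suminf_nonneg) auto
  have E: "(\<integral>\<^sup>+z. ennreal ((cmod (ladder p q h z))\<^sup>2) \<partial>gauss) = ennreal (pi * suminf (wsq (ladder_seq p q (tcoef h))))"
    "(\<integral>\<^sup>+z. ennreal ((cmod (ladder q p h z))\<^sup>2) \<partial>gauss) = ennreal (pi * suminf (wsq (ladder_seq q p (tcoef h))))"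
    using 2 3(1) gauss_norm_wsq(2)[OF ladder_holomorphic[OF h]] by (simp_all add: tcoef_ladder[OF h])
  have "pi * suminf (wsq (ladder_seq q p (tcoef h))) + q\<^sup>2 * (pi * suminf (wsq (tcoef h)))
      = pi * suminf (wsq (ladder_seq p q (tcoef h))) + p\<^sup>2 * (pi * suminf (wsq (tcoef h)))"
    using arg_cong[OF 3(2), of "\<lambda>x. pi * x"] by (simp add: algebra_simps)
  then show ?thesis
    unfolding E gauss_norm_wsq(2)[OF h 1] using nn[OF 1] nn[OF 2] nn[OF 3(1)]
    by (simp flip: ennreal_mult ennreal_plus)
qed

section \<open>Square integrability and the polarised Parseval identity\<close>

definition sq_int :: "'a measure \<Rightarrow> ('a \<Rightarrow> complex) \<Rightarrow> bool" where
  "sq_int M f \<longleftrightarrow> f \<in> borel_measurable M \<and> (\<integral>\<^sup>+x. ennreal ((cmod (f x))\<^sup>2) \<partial>M) < \<infinity>"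

lemma sq_intD:
  assumes "sq_int M f"
  shows "f \<in> borel_measurable M" "integrable M (\<lambda>x. (cmod (f x))\<^sup>2)"
    "(\<integral>\<^sup>+x. ennreal ((cmod (f x))\<^sup>2) \<partial>M) = ennreal (LINT x|M. (cmod (f x))\<^sup>2)"
proof -
  show f: "f \<in> borel_measurable M"
    using assms by (simp add: sq_int_def)
  then show i: "integrable M (\<lambda>x. (cmod (f x))\<^sup>2)"
    using assms by (intro integrableI_nonneg) (auto simp: sq_int_def)
  then show "(\<integral>\<^sup>+x. ennreal ((cmod (f x))\<^sup>2) \<partial>M) = ennreal (LINT x|M. (cmod (f x))\<^sup>2)"
    by (intro nn_integral_eq_integral) auto
qed

lemma sq_intI:
  assumes "f \<in> borel_measurable M" "integrable M (\<lambda>x. (cmod (f x))\<^sup>2)"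
  shows "sq_int M f"
  using assms by (simp add: sq_int_def nn_integral_eq_integral)

lemma sq_int_cmult: "sq_int M f \<Longrightarrow> sq_int M (\<lambda>x. c * f x)"
  using sq_intD(1,2)[of M f] by (intro sq_intI) (auto simp: norm_mult power_mult_distrib)

lemma sq_int_add:
  assumes f: "sq_int M f" and g: "sq_int M g"
  shows "sq_int M (\<lambda>x. f x + g x)"
proof (rule sq_intI)
  note [measurable] = sq_intD(1)[OF f] sq_intD(1)[OF g]
  show "(\<lambda>x. f x + g x) \<in> borel_measurable M" by measurable
  have le: "(cmod (f x + g x))\<^sup>2 \<le> 2 * (cmod (f x))\<^sup>2 + 2 * (cmod (g x))\<^sup>2" for x
  proof -
    have "(cmod (f x + g x))\<^sup>2 \<le> (cmod (f x) + cmod (g x))\<^sup>2"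
      by (intro power_mono norm_triangle_ineq) auto
    also have "\<dots> \<le> 2 * (cmod (f x))\<^sup>2 + 2 * (cmod (g x))\<^sup>2"
      using sum_squares_bound[of "cmod (f x)" "cmod (g x)"] by (simp add: power2_sum)
    finally show ?thesis .
  qed
  show "integrable M (\<lambda>x. (cmod (f x + g x))\<^sup>2)"
    by (rule Bochner_Integration.integrable_bound[where f="\<lambda>x. 2 * (cmod (f x))\<^sup>2 + 2 * (cmod (g x))\<^sup>2"])
       (auto intro!: sq_intD(2) f g AE_I2 simp: le abs_of_nonneg)
qed

lemma sq_int_prod_integrable:
  assumes f: "sq_int M f" and g: "sq_int M g"
  shows "integrable M (\<lambda>x. f x * cnj (g x))"
proof -
  note [measurable] = sq_intD(1)[OF f] sq_intD(1)[OF g]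
  have m: "(\<lambda>x. cnj (g x)) \<in> borel_measurable M"
    by (rule measurable_compose[OF sq_intD(1)[OF g]]) (intro borel_measurable_continuous_onI continuous_intros)
  have le: "cmod (f x) * cmod (g x) \<le> (cmod (f x))\<^sup>2 + (cmod (g x))\<^sup>2" for x
    using sum_squares_bound[of "cmod (f x)" "cmod (g x)"] mult_nonneg_nonneg[OF norm_ge_zero[of "f x"] norm_ge_zero[of "g x"]]
    unfolding mult.assoc by linarith
  show ?thesis
    by (rule Bochner_Integration.integrable_bound[where f="\<lambda>x. (cmod (f x))\<^sup>2 + (cmod (g x))\<^sup>2"])
       (use m le in \<open>auto intro!: sq_intD(2) f g AE_I2 borel_measurable_times simp: norm_mult\<close>)
qed

lemma complex_polarization:
  "4 * (z * cnj w) = of_real ((cmod (z + w))\<^sup>2) - of_real ((cmod (z + (-1) * w))\<^sup>2)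
     + \<i> * of_real ((cmod (z + \<i> * w))\<^sup>2) - \<i> * of_real ((cmod (z + (- \<i>) * w))\<^sup>2)"
  unfolding complex_norm_square by (simp add: algebra_simps)

text \<open>Parseval for \<open>h + c * g\<close> with \<open>c\<close> running through the four
  fourth roots of unity, recombined by polarization. No new interchange of sum and integral is
  needed.\<close>

theorem gauss_parseval_inner:
  assumes h: "h holomorphic_on UNIV" "sq_int gauss h" and g: "g holomorphic_on UNIV" "sq_int gauss g"
  shows "(\<lambda>n. of_real pi * (fact n * tcoef h n * cnj (tcoef g n))) sums (LINT z|gauss. h z * cnj (g z))"
proof -
  define F where "F c z = h z + c * g z" for c z
  have holF: "F c holomorphic_on UNIV" for c
    unfolding F_def[abs_def] by (intro holomorphic_intros h g)
  have sqF: "sq_int gauss (F c)" for c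
    unfolding F_def[abs_def] by (intro sq_int_add sq_int_cmult h g)
  have tF: "tcoef (F c) n = tcoef h n + c * tcoef g n" for c n
    unfolding F_def[abs_def] using h g
    by (subst tcoef_add) (auto intro!: holomorphic_intros simp: tcoef_cmult)
  have sums: "(\<lambda>n. of_real (pi * (fact n * (cmod (tcoef h n + c * tcoef g n))\<^sup>2))) sums (of_real (LINT z|gauss. (cmod (F c z))\<^sup>2) :: complex)" for c
  proof -
    have s: "summable (wsq (tcoef (F c)))"
      using sqF[of c] unfolding sq_int_def gauss_norm_wsq(1)[OF holF] by simp
    then have "ennreal (LINT z|gauss. (cmod (F c z))\<^sup>2) = ennreal (pi * suminf (wsq (tcoef (F c))))"
      using gauss_norm_wsq(2)[OF holF s] sq_intD(3)[OF sqF[of c]] by simp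
    then have eq: "(LINT z|gauss. (cmod (F c z))\<^sup>2) = pi * suminf (wsq (tcoef (F c)))"
      using s by (subst (asm) ennreal_inj) (auto intro!: integral_nonneg_AE mult_nonneg_nonneg suminf_nonneg)
    have "(\<lambda>n. pi * wsq (tcoef (F c)) n) sums (pi * suminf (wsq (tcoef (F c))))"
      by (intro sums_mult summable_sums s)
    then show ?thesis
      unfolding eq[symmetric] by (subst sums_of_real_iff) (simp add: wsq_def tF)
  qed
  have int: "integrable gauss (\<lambda>z. complex_of_real ((cmod (F c z))\<^sup>2))" for c
    by (intro integrable_of_real sq_intD sqF)
  have I: "(LINT z|gauss. 4 * (h z * cnj (g z)))
      = of_real (LINT z|gauss. (cmod (F 1 z))\<^sup>2) - of_real (LINT z|gauss. (cmod (F (-1) z))\<^sup>2)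
        + \<i> * of_real (LINT z|gauss. (cmod (F \<i> z))\<^sup>2) - \<i> * of_real (LINT z|gauss. (cmod (F (-\<i>) z))\<^sup>2)"
  proof -
    have "(LINT z|gauss. 4 * (h z * cnj (g z))) = (LINT z|gauss. of_real ((cmod (F 1 z))\<^sup>2) - of_real ((cmod (F (-1) z))\<^sup>2)
     + \<i> * of_real ((cmod (F \<i> z))\<^sup>2) - \<i> * of_real ((cmod (F (- \<i>) z))\<^sup>2))"
      unfolding complex_polarization F_def by simp
    also have "\<dots> = of_real (LINT z|gauss. (cmod (F 1 z))\<^sup>2) - of_real (LINT z|gauss. (cmod (F (-1) z))\<^sup>2)
        + \<i> * of_real (LINT z|gauss. (cmod (F \<i> z))\<^sup>2) - \<i> * of_real (LINT z|gauss. (cmod (F (-\<i>) z))\<^sup>2)"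
      using int
      by (subst Bochner_Integration.integral_diff Bochner_Integration.integral_add, 
          intro Bochner_Integration.integrable_diff Bochner_Integration.integrable_add integrable_mult_right int,
          intro integrable_mult_right int)+
         (simp only: integral_mult_right_zero integral_complex_of_real)
    finally show ?thesis .
  qed
  have "(\<lambda>n. of_real (pi * (fact n * (cmod (tcoef h n + 1 * tcoef g n))\<^sup>2))
      - of_real (pi * (fact n * (cmod (tcoef h n + (-1) * tcoef g n))\<^sup>2))
      + \<i> * of_real (pi * (fact n * (cmod (tcoef h n + \<i> * tcoef g n))\<^sup>2))
      - \<i> * of_real (pi * (fact n * (cmod (tcoef h n + (-\<i>) * tcoef g n))\<^sup>2))) sums (LINT z|gauss. 4 * (h z * cnj (g z)))"
    unfolding I by (intro sums_diff sums_add sums_mult sums)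
  also have "(\<lambda>n. of_real (pi * (fact n * (cmod (tcoef h n + 1 * tcoef g n))\<^sup>2))
      - of_real (pi * (fact n * (cmod (tcoef h n + (-1) * tcoef g n))\<^sup>2))
      + \<i> * of_real (pi * (fact n * (cmod (tcoef h n + \<i> * tcoef g n))\<^sup>2))
      - \<i> * of_real (pi * (fact n * (cmod (tcoef h n + (-\<i>) * tcoef g n))\<^sup>2)))
    = (\<lambda>n. of_real pi * (fact n * (4 * (tcoef h n * cnj (tcoef g n)))))"
    unfolding complex_polarization by (simp add: algebra_simps fun_eq_iff)
  finally have "(\<lambda>n. 4 * (of_real pi * (fact n * tcoef h n * cnj (tcoef g n)))) sums (4 * (LINT z|gauss. h z * cnj (g z)))"
    unfolding integral_mult_right_zero by (simp add: mult_ac)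
  then show ?thesis
    by (subst (asm) sums_mult_iff) auto
qed

theorem gauss_ladder_adjoint:
  assumes h: "h holomorphic_on UNIV" "sq_int gauss h" and g: "g holomorphic_on UNIV" "sq_int gauss g"
    and "sq_int gauss (ladder p q h)" "sq_int gauss (ladder q p g)"
  shows "(LINT z|gauss. ladder p q h z * cnj (g z)) = (LINT z|gauss. h z * cnj (ladder q p g z))"
proof -
  have "(\<lambda>n. (1 / of_real pi) * (of_real pi * (fact n * ladder_seq p q (tcoef h) n * cnj (tcoef g n)))) sums
      ((1 / of_real pi) * (LINT z|gauss. ladder p q h z * cnj (g z)))"
    using gauss_parseval_inner[of "ladder p q h" g] assms
    by (intro sums_mult) (simp add: ladder_holomorphic tcoef_ladder)
  moreover have "(\<lambda>n. (1 / of_real pi) * (of_real pi * (fact n * tcoef h n * cnj (ladder_seq q p (tcoef g) n)))) sums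
      ((1 / of_real pi) * (LINT z|gauss. h z * cnj (ladder q p g z)))"
    using gauss_parseval_inner[of h "ladder q p g"] assms
    by (intro sums_mult) (simp add: ladder_holomorphic tcoef_ladder)
  moreover have "summable (wsq (tcoef h))" "summable (wsq (tcoef g))"
    using h g gauss_norm_wsq(1) by (auto simp: sq_int_def)
  ultimately have "(1 / complex_of_real pi) * (LINT z|gauss. ladder p q h z * cnj (g z))
      = (1 / of_real pi) * (LINT z|gauss. h z * cnj (ladder q p g z))"
    by (intro ladder_seq_adjoint[of "tcoef h" "tcoef g"]) auto
  then show ?thesis by simp
qed

lemma sq_int_monomial: "sq_int gauss (\<lambda>z. z ^ k)"
  by (simp add: sq_int_def norm_power power_mult[symmetric] gauss_moment[of k, unfolded mult.commute[of 2 k]])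

text \<open>Only the \<open>k\<close>-th term of the Parseval series survives, so testing against
  monomials reads off Taylor coefficients.\<close>

lemma gauss_monomial_inner:
  assumes g: "g holomorphic_on UNIV" "sq_int gauss g"
  shows "(LINT z|gauss. z ^ k * cnj (g z)) = of_real (pi * fact k) * cnj (tcoef g k)"
proof -
  have "(\<lambda>n. of_real pi * (fact n * tcoef (\<lambda>z. z ^ k) n * cnj (tcoef g n))) sums (LINT z|gauss. z ^ k * cnj (g z))"
    by (rule gauss_parseval_inner[OF _ sq_int_monomial g]) (intro holomorphic_intros)
  also have "(\<lambda>n. of_real pi * (fact n * tcoef (\<lambda>z. z ^ k) n * cnj (tcoef g n)))
      = (\<lambda>n. if n = k then of_real pi * (fact n * cnj (tcoef g n)) else 0)"
    by (auto simp: tcoef_monomial)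
  finally show ?thesis
    using sums_single[of k "\<lambda>n. of_real pi * (fact n * cnj (tcoef g n))"] sums_unique2 by fastforce
qed

section \<open>Entire functions of two variables\<close>

definition circ :: "real \<Rightarrow> complex" where
  "circ t = exp (2 * of_real pi * \<i> * of_real t)"

lemma circ_nz [simp]: "circ t \<noteq> 0"
  by (simp add: circ_def)

lemma continuous_on_circ [continuous_intros]: "continuous_on S f \<Longrightarrow> continuous_on S (\<lambda>x. circ (f x))"
  unfolding circ_def by (intro continuous_intros)

text \<open>Cauchy's formula on the unit circle around \<open>v\<close>. Writing the derivative as
  an integral of function values over a compact interval lets continuity and holomorphy in a second
  variable pass through it.\<close>

lemma deriv_circ_integral:
  assumes "h holomorphic_on UNIV"
  shows "deriv h v = integral {0..1} (\<lambda>t. h (v + circ t) / circ t)"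
proof -
  have "contour_integral (circlepath v 1) (\<lambda>u. h u / (u - v)\<^sup>2) = (2 * pi * \<i>) * deriv h v"
    using assms by (intro Cauchy_contour_integral_circlepath_2 holomorphic_on_imp_continuous_on)
      (auto intro: holomorphic_on_subset)
  moreover have "contour_integral (circlepath v 1) (\<lambda>u. h u / (u - v)\<^sup>2)
      = integral {0..1} (\<lambda>t. (2 * pi * \<i>) * (h (v + circ t) / circ t))"
    unfolding contour_integral_integral vector_derivative_circlepath
    by (intro integral_cong) (simp add: circlepath circ_def[symmetric] power2_eq_square)
  ultimately show ?thesis by (simp del: times_divide_eq_right)
qed

text \<open>Jointly continuous and separately holomorphic, which is equivalent to entire. The
  curried form lets the one-variable theory be applied to each section.\<close>

definition sep_entire :: "(complex \<Rightarrow> complex \<Rightarrow> complex) \<Rightarrow> bool" where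
  "sep_entire F \<longleftrightarrow> continuous_on UNIV (\<lambda>(w, v). F w v)
     \<and> (\<forall>v. (\<lambda>w. F w v) holomorphic_on UNIV) \<and> (\<forall>w. F w holomorphic_on UNIV)"

lemma continuous_curried_flip:
  "continuous_on UNIV (\<lambda>(w, v). G w v) \<Longrightarrow> continuous_on UNIV (\<lambda>(v, w). G w v)"
  by (rule continuous_on_swap_args[of UNIV UNIV, unfolded UNIV_Times_UNIV])

lemma continuous_on_curried:
  assumes "continuous_on UNIV (\<lambda>(w, v). G w v)" "continuous_on S f" "continuous_on S g"
  shows "continuous_on S (\<lambda>x. G (f x) (g x))"
  using continuous_on_compose2[OF assms(1) continuous_on_Pair[OF assms(2,3)]] by simp

lemma sep_entire_flip: "sep_entire F \<Longrightarrow> sep_entire (\<lambda>v w. F w v)"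
  unfolding sep_entire_def by (blast intro: continuous_curried_flip)

lemma sep_entireD:
  assumes "sep_entire F"
  shows "(\<lambda>w. F w v) holomorphic_on UNIV" "F w holomorphic_on UNIV" "continuous_on UNIV (\<lambda>(w, v). F w v)"
  using assms by (auto simp: sep_entire_def)

lemma continuous_on_sep_entire:
  assumes "sep_entire F" "continuous_on S f" "continuous_on S g"
  shows "continuous_on S (\<lambda>x. F (f x) (g x))"
  using continuous_on_curried[OF sep_entireD(3)[OF assms(1)] assms(2,3)] .

lemma continuous_deriv_snd:
  assumes F: "sep_entire F"
  shows "continuous_on UNIV (\<lambda>(w, v). deriv (F w) v)"
proof -
  have "continuous_on UNIV (\<lambda>p. integral (cbox 0 1) (\<lambda>t. F (fst p) (snd p + circ t) / circ t))"
    by (rule integral_continuous_on_param)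
       (auto simp: split_beta intro!: continuous_intros continuous_on_sep_entire[OF F])
  then show ?thesis
    by (simp add: split_beta deriv_circ_integral[OF sep_entireD(2)[OF F]])
qed

lemma continuous_deriv_fst:
  assumes F: "sep_entire F"
  shows "continuous_on UNIV (\<lambda>(w, v). deriv (\<lambda>w. F w v) w)"
  by (rule continuous_curried_flip[OF continuous_deriv_snd[OF sep_entire_flip[OF F]]])

lemma deriv_snd_has_derivative:
  assumes F: "sep_entire F"
  shows "((\<lambda>w. deriv (F w) v) has_field_derivative
      integral {0..1} (\<lambda>t. deriv (\<lambda>w. F w (v + circ t)) w / circ t)) (at w)"
proof -
  have "((\<lambda>w. integral (cbox 0 1) (\<lambda>t. F w (v + circ t) / circ t)) has_field_derivative
      integral (cbox 0 1) (\<lambda>t. deriv (\<lambda>w. F w (v + circ t)) w / circ t)) (at w within UNIV)"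
  proof (rule leibniz_rule_field_derivative)
    show "((\<lambda>w. F w (v + circ t) / circ t) has_field_derivative deriv (\<lambda>w. F w (v + circ t)) w / circ t) (at w within UNIV)" for w t
      using sep_entireD(1)[OF F, of "v + circ t"]
      by (intro DERIV_cdivide holomorphic_derivI[where S=UNIV]) auto
    show "(\<lambda>t. F w (v + circ t) / circ t) integrable_on cbox 0 1" for w
      by (intro integrable_continuous continuous_intros continuous_on_sep_entire[OF F]) auto
    have "continuous_on S (\<lambda>p. deriv (\<lambda>w. F w (v + circ (snd p))) (fst p))" for S
      by (rule continuous_on_curried[OF continuous_deriv_fst[OF F]]) (intro continuous_intros)+
    then show "continuous_on (UNIV \<times> cbox 0 1) (\<lambda>(w, t). deriv (\<lambda>w. F w (v + circ t)) w / circ t)"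
      by (auto simp: split_beta intro!: continuous_intros)
  qed auto
  then show ?thesis
    by (simp add: deriv_circ_integral[OF sep_entireD(2)[OF F]])
qed

lemma sep_entire_deriv_snd:
  assumes F: "sep_entire F"
  shows "sep_entire (\<lambda>w v. deriv (F w) v)"
  unfolding sep_entire_def
proof (intro conjI allI)
  show "continuous_on UNIV (\<lambda>(w, v). deriv (F w) v)"
    by (rule continuous_deriv_snd[OF F])
  show "(\<lambda>w. deriv (F w) v) holomorphic_on UNIV" for v
    using deriv_snd_has_derivative[OF F] by (subst holomorphic_on_open) auto
  show "deriv (F w) holomorphic_on UNIV" for w
    using sep_entireD(2)[OF F] by (intro holomorphic_deriv) auto
qed

lemma sep_entire_deriv_fst:
  assumes F: "sep_entire F"
  shows "sep_entire (\<lambda>w v. deriv (\<lambda>w. F w v) w)"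
  using sep_entire_flip[OF sep_entire_deriv_snd[OF sep_entire_flip[OF F]]] by simp

text \<open>Differentiating the Cauchy integral for the derivative in \<open>v\<close> under the
  integral sign gives the Cauchy integral of the derivative in \<open>w\<close>.\<close>

lemma deriv_commute:
  assumes F: "sep_entire F"
  shows "deriv (\<lambda>w. deriv (F w) v) w = deriv (\<lambda>v. deriv (\<lambda>w. F w v) w) v"
proof -
  have "deriv (\<lambda>w. deriv (F w) v) w = integral {0..1} (\<lambda>t. deriv (\<lambda>w. F w (v + circ t)) w / circ t)"
    by (rule DERIV_imp_deriv[OF deriv_snd_has_derivative[OF F]])
  also have "\<dots> = deriv (\<lambda>v. deriv (\<lambda>w. F w v) w) v"
    using sep_entireD(2)[OF sep_entire_deriv_fst[OF F]] by (intro deriv_circ_integral[symmetric])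
  finally show ?thesis .
qed

lemma sep_entire_has_derivative:
  assumes F: "sep_entire F"
  shows "((\<lambda>(w, v). F w v) has_derivative
      (\<lambda>(s, t). deriv (\<lambda>w. F w v) w * s + deriv (F w) v * t)) (at (w, v))"
proof -
  \<comment> \<open>The criterion by partial derivatives asks for continuity of the second one as an
    operator, hence the bounded linear function in place of a product.\<close>
  have "((\<lambda>(w, v). F w v) has_derivative
      (\<lambda>(s, t). deriv (\<lambda>w. F w v) w * s + blinfun_apply (blinfun_mult_right (deriv (F w) v)) t)) (at (w, v) within UNIV \<times> UNIV)"
  proof (rule has_derivative_partialsI)
    show "((\<lambda>w. F w v) has_derivative (*) (deriv (\<lambda>w. F w v) w)) (at w within UNIV)"
      using holomorphic_derivI[OF sep_entireD(1)[OF F], of w] by (simp add: has_field_derivative_def)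
    show "(F w has_derivative blinfun_apply (blinfun_mult_right (deriv (F w) v))) (at v within UNIV)" for w v
      using holomorphic_derivI[OF sep_entireD(2)[OF F], of v] by (simp add: has_field_derivative_def)
    have "continuous_on UNIV (\<lambda>p. blinfun_mult_right (case p of (w, v) \<Rightarrow> deriv (F w) v))"
      by (intro bounded_linear.continuous_on[OF bounded_linear_blinfun_mult_right] continuous_deriv_snd[OF F])
    then show "continuous (at (w, v) within UNIV \<times> UNIV) (\<lambda>(w, v). blinfun_mult_right (deriv (F w) v))"
      unfolding case_prod_unfold continuous_on_eq_continuous_within by simp
  qed auto
  then show ?thesis by simp
qed

section \<open>Slices along the coordinate axes\<close>

definition slice :: "2 \<Rightarrow> 2 \<Rightarrow> cfun \<Rightarrow> complex \<Rightarrow> complex \<Rightarrow> complex" where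
  "slice j k f w v = f (axis j w + axis k v)"

lemma ex_other: "\<exists>k::2. j \<noteq> k"
  using exhaust_2[of j] by (metis one_neq_zero zero_neq_numeral add_cancel_right_right one_add_one)

lemma slice_flip: "slice k j f v w = slice j k f w v"
  by (simp add: slice_def add.commute)

lemma vec_decompose:
  assumes "j \<noteq> (k::2)"
  shows "z = axis j (z $ j) + axis k (z $ k :: complex)"
proof -
  have "i = j \<or> i = k" for i using UNIV_2_eq[OF assms] by auto
  then show ?thesis
    using assms by (auto simp: vec_eq_iff axis_def)
qed

lemma slice_inverse: "j \<noteq> k \<Longrightarrow> slice j k f (z $ j) (z $ k) = f z"
  unfolding slice_def using vec_decompose[of j k z] by simp

lemma axis_has_derivative: "((\<lambda>w. axis j w :: complex ^ 2) has_derivative axis j) (at w)"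
proof -
  have "bounded_linear (axis j :: complex \<Rightarrow> complex ^ 2)"
    unfolding linear_conv_bounded_linear[symmetric] by (rule linearI) (auto simp: axis_def vec_eq_iff)
  then show ?thesis by (rule bounded_linear_imp_has_derivative)
qed

lemma entire2_slice_12: "entire2 f \<longleftrightarrow> sep_entire (slice 1 2 f)"
proof
  assume f: "entire2 f"
  have cont: "continuous_on UNIV f"
    using f unfolding entire2_def continuous_on_eq_continuous_at[OF open_UNIV]
    by (meson has_derivative_continuous)
  have c_axis: "continuous_on UNIV (axis i :: complex \<Rightarrow> complex ^ 2)" for i
    using axis_has_derivative by (auto simp: continuous_on_eq_continuous_at intro!: has_derivative_continuous)
  have hol: "(\<lambda>w. f (axis i w + c)) holomorphic_on UNIV" for i :: 2 and c
  proof -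
    have "\<exists>d. ((\<lambda>w. f (axis i w + c)) has_field_derivative d) (at w)" for w
    proof -
      obtain d :: "complex ^ 2" where d: "(f has_derivative (\<lambda>h. d $ 1 * h $ 1 + d $ 2 * h $ 2)) (at (axis i w + c))"
        using f unfolding entire2_def by blast
      have "((\<lambda>w. axis i w + c) has_derivative axis i) (at w)"
        using axis_has_derivative by (auto intro!: derivative_eq_intros)
      from has_derivative_compose[OF this d]
      have "((\<lambda>w. f (axis i w + c)) has_derivative (\<lambda>h. d $ 1 * axis i h $ 1 + d $ 2 * axis i h $ 2)) (at w)" .
      moreover have "(\<lambda>h. d $ 1 * axis i h $ 1 + d $ 2 * axis i h $ 2) = (*) (d $ i)"
        using exhaust_2[of i] by (auto simp: axis_def)
      ultimately show ?thesis
        by (auto simp: has_field_derivative_def)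
    qed
    then show ?thesis by (subst holomorphic_on_open) auto
  qed
  show "sep_entire (slice 1 2 f)"
    unfolding sep_entire_def slice_def[abs_def] split_beta
    using hol[of 1] hol[of 2, unfolded add.commute[of "axis 2 _"]]
    by (auto intro!: continuous_on_compose2[OF cont] continuous_intros continuous_on_compose2[OF c_axis])
next
  assume F: "sep_entire (slice 1 2 f)"
  show "entire2 f"
    unfolding entire2_def
  proof
    fix z :: "complex ^ 2"
    define c :: "complex ^ 2" where
      "c = axis 1 (deriv (\<lambda>w. slice 1 2 f w (z $ 2)) (z $ 1)) + axis 2 (deriv (slice 1 2 f (z $ 1)) (z $ 2))"
    have "((\<lambda>z. (z $ 1, z $ 2)) has_derivative (\<lambda>h. (h $ 1, h $ 2))) (at z)"
      by (intro has_derivative_Pair bounded_linear_imp_has_derivative bounded_linear_vec_nth)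
    from has_derivative_compose[OF this sep_entire_has_derivative[OF F]]
    have "(f has_derivative (\<lambda>h. c $ 1 * h $ 1 + c $ 2 * h $ 2)) (at z)"
      by (simp add: slice_inverse c_def axis_def)
    then show "\<exists>c :: complex ^ 2. (f has_derivative (\<lambda>h. c $ 1 * h $ 1 + c $ 2 * h $ 2)) (at z)" ..
  qed
qed

lemma entire2_slice:
  assumes "j \<noteq> k"
  shows "entire2 f \<longleftrightarrow> sep_entire (slice j k f)"
proof (cases "j = 1")
  case True
  then have "k = 2" using assms exhaust_2[of k] by auto
  with True show ?thesis using entire2_slice_12 by simp
next
  case False
  then have "j = 2" "k = 1" using assms exhaust_2[of k] exhaust_2[of j] by auto
  moreover have "slice 2 1 f = (\<lambda>v w. slice 1 2 f w v)" "slice 1 2 f = (\<lambda>v w. slice 2 1 f w v)"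
    by (intro ext slice_flip)+
  ultimately show ?thesis
    using entire2_slice_12[of f] sep_entire_flip[of "slice 1 2 f"] sep_entire_flip[of "slice 2 1 f"]
    by metis
qed

lemma slice_partial_fst:
  "slice j k (partial_deriv j f) w v = deriv (\<lambda>w. slice j k f w v) w"
  unfolding slice_def partial_deriv_def
proof -
  have "axis j w + axis k v + axis j x = axis j (w + x) + (axis k v :: complex ^ 2)" for x
    by (auto simp: vec_eq_iff axis_def)
  then show "deriv (\<lambda>x. f (axis j w + axis k v + axis j x)) 0 = deriv (\<lambda>w. f (axis j w + axis k v)) w"
    by (subst (2) deriv_shift_0) (simp only: o_def)
qed

lemma slice_partial_snd:
  "slice j k (partial_deriv k f) w v = deriv (slice j k f w) v"
  using slice_partial_fst[of k j f v w] unfolding slice_flip[of k j] .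

lemma entire2_partial_deriv:
  assumes f: "entire2 f"
  shows "entire2 (partial_deriv j f)"
proof -
  obtain k where k: "j \<noteq> k" using ex_other by blast
  show ?thesis
    using sep_entire_deriv_fst f unfolding entire2_slice[OF k]
    by (simp add: slice_partial_fst[abs_def])
qed

lemma partial_deriv_commute:
  assumes f: "entire2 f"
  shows "partial_deriv j (partial_deriv k f) = partial_deriv k (partial_deriv j f)"
proof (cases "j = k")
  case False
  show ?thesis
  proof
    fix z
    have "slice j k (partial_deriv j (partial_deriv k f)) w v = slice j k (partial_deriv k (partial_deriv j f)) w v" for w v
      unfolding slice_partial_fst slice_partial_snd
      using f unfolding entire2_slice[OF False] by (rule deriv_commute)
    from this[of "z $ j" "z $ k"] show "partial_deriv j (partial_deriv k f) z = partial_deriv k (partial_deriv j f) z"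
      unfolding slice_inverse[OF False] .
  qed
qed simp

section \<open>Ladder operators in one of two variables\<close>

lemma sep_entireI:
  assumes "continuous_on UNIV (\<lambda>p. F (fst p) (snd p))"
    "\<And>v. (\<lambda>w. F w v) holomorphic_on UNIV" "\<And>w. (\<lambda>v. F w v) holomorphic_on UNIV"
  shows "sep_entire F"
  using assms unfolding sep_entire_def case_prod_unfold by simp

lemma
  assumes "sep_entire F" "sep_entire G"
  shows sep_entire_add: "sep_entire (\<lambda>w v. F w v + G w v)"
    and sep_entire_mult: "sep_entire (\<lambda>w v. F w v * G w v)"
  by (intro sep_entireI continuous_intros holomorphic_intros continuous_on_sep_entire[OF assms(1)]
      continuous_on_sep_entire[OF assms(2)] sep_entireD(1)[OF assms(1)] sep_entireD(1)[OF assms(2)]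
      sep_entireD(2)[OF assms(1)] sep_entireD(2)[OF assms(2)])+

lemma sep_entire_const: "sep_entire (\<lambda>w v. c)"
  and sep_entire_fst: "sep_entire (\<lambda>w v. w)"
  and sep_entire_snd: "sep_entire (\<lambda>w v. v)"
  by (intro sep_entireI continuous_intros holomorphic_intros)+

lemma sep_entire_of_fst:
  assumes "f holomorphic_on UNIV"
  shows "sep_entire (\<lambda>w v. f w)"
proof (rule sep_entireI)
  show "continuous_on UNIV (\<lambda>p. f (fst p))"
    by (rule continuous_on_compose2[OF holomorphic_on_imp_continuous_on[OF assms], of UNIV fst])
       (intro continuous_on_fst continuous_on_id, simp_all)
qed (use assms in auto)

definition ladder_fst :: "real \<Rightarrow> real \<Rightarrow> (complex \<Rightarrow> complex \<Rightarrow> complex) \<Rightarrow> complex \<Rightarrow> complex \<Rightarrow> complex" where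
  "ladder_fst p q F w v = ladder p q (\<lambda>w. F w v) w"

lemma sep_entire_ladder_fst:
  assumes "sep_entire F"
  shows "sep_entire (ladder_fst p q F)"
  unfolding ladder_fst_def[abs_def] ladder_def[abs_def]
  by (intro sep_entire_add sep_entire_mult sep_entire_const sep_entire_fst sep_entire_deriv_fst assms)

lemma measurable_gauss_pair:
  fixes f :: "complex \<times> complex \<Rightarrow> 'a::topological_space"
  assumes "continuous_on UNIV f"
  shows "f \<in> borel_measurable (gauss \<Otimes>\<^sub>M gauss)"
proof -
  have "sets (gauss \<Otimes>\<^sub>M gauss) = sets (borel :: (complex \<times> complex) measure)"
    unfolding borel_prod[symmetric] by (intro sets_pair_measure_cong) auto
  then show ?thesis
    using borel_measurable_continuous_onI[OF assms] by (simp cong: measurable_cong_sets)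
qed

lemma sep_entire_measurable:
  assumes "sep_entire F"
  shows "(\<lambda>(v, w). F w v) \<in> borel_measurable (gauss \<Otimes>\<^sub>M gauss)"
  by (rule measurable_gauss_pair) (auto simp: split_beta intro!: continuous_on_sep_entire[OF assms] continuous_intros)

lemma sep_entire_measurable_fst:
  assumes "sep_entire F"
  shows "(\<lambda>w. F w v) \<in> borel_measurable gauss"
  using borel_measurable_continuous_onI[OF holomorphic_on_imp_continuous_on[OF sep_entireD(1)[OF assms]]]
  by (simp cong: measurable_cong_sets)

text \<open>Pairs are ordered as \<open>(v, w)\<close>, so that the inner integral of Fubini's theorem is over the first
  argument \<open>w\<close> of \<open>F\<close>, on which the ladder operators act.\<close>
definition sq_int2 :: "(complex \<Rightarrow> complex \<Rightarrow> complex) \<Rightarrow> bool" where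
  "sq_int2 F \<longleftrightarrow> sq_int (gauss \<Otimes>\<^sub>M gauss) (\<lambda>(v, w). F w v)"

lemma nn_integral_gauss_pair:
  assumes "sep_entire F"
  shows "(\<integral>\<^sup>+(v, w). ennreal ((cmod (F w v))\<^sup>2) \<partial>(gauss \<Otimes>\<^sub>M gauss))
     = (\<integral>\<^sup>+v. \<integral>\<^sup>+w. ennreal ((cmod (F w v))\<^sup>2) \<partial>gauss \<partial>gauss)"
proof -
  have [measurable]: "(\<lambda>p. F (snd p) (fst p)) \<in> borel_measurable (gauss \<Otimes>\<^sub>M gauss)"
    using sep_entire_measurable[OF assms] by (simp add: split_beta')
  have "(\<lambda>p. ennreal ((cmod (F (snd p) (fst p)))\<^sup>2)) \<in> borel_measurable (gauss \<Otimes>\<^sub>M gauss)"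
    by measurable
  from gauss.nn_integral_fst[OF this] show ?thesis
    by (simp add: split_beta')
qed

lemma measurable_gauss_section:
  assumes "sep_entire F"
  shows "(\<lambda>v. \<integral>\<^sup>+w. ennreal ((cmod (F w v))\<^sup>2) \<partial>gauss) \<in> borel_measurable gauss"
proof -
  have [measurable]: "(\<lambda>p. F (snd p) (fst p)) \<in> borel_measurable (gauss \<Otimes>\<^sub>M gauss)"
    using sep_entire_measurable[OF assms] by (simp add: split_beta')
  have "(\<lambda>p. ennreal ((cmod (F (snd p) (fst p)))\<^sup>2)) \<in> borel_measurable (gauss \<Otimes>\<^sub>M gauss)"
    by measurable
  from gauss.borel_measurable_nn_integral_fst[OF this] show ?thesis
    by simp
qed

lemma sq_int2_iff:
  assumes "sep_entire F"
  shows "sq_int2 F \<longleftrightarrow> (\<integral>\<^sup>+v. \<integral>\<^sup>+w. ennreal ((cmod (F w v))\<^sup>2) \<partial>gauss \<partial>gauss) < \<infinity>"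
  using nn_integral_gauss_pair[OF assms] sep_entire_measurable[OF assms]
  by (simp add: sq_int2_def sq_int_def split_beta')

text \<open>A finite iterated integral has finite inner integrals almost everywhere. Individual
  sections may fail, so the one-variable theorems are available for almost every \<open>v\<close>
  only.\<close>

lemma sq_int2_AE:
  assumes F: "sep_entire F" "sq_int2 F"
  shows "AE v in gauss. sq_int gauss (\<lambda>w. F w v)"
proof -
  have "AE v in gauss. (\<integral>\<^sup>+w. ennreal ((cmod (F w v))\<^sup>2) \<partial>gauss) \<noteq> \<infinity>"
    using F(2) unfolding sq_int2_iff[OF F(1)]
    by (intro nn_integral_PInf_AE measurable_gauss_section[OF F(1)]) auto
  then show ?thesis
    by eventually_elim (simp add: sq_int_def sep_entire_measurable_fst[OF F(1), simplified] less_top)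
qed

text \<open>The one-variable identity is integrated over \<open>v\<close>. As it lives in the
  extended nonnegative reals, finiteness of the right-hand side yields square integrability of the
  swapped operator's value.\<close>

lemma ladder_fst_swap:
  assumes F: "sep_entire F" "sq_int2 F" and L: "sq_int2 (ladder_fst p q F)"
  shows "(\<integral>\<^sup>+v. \<integral>\<^sup>+w. ennreal ((cmod (ladder_fst q p F w v))\<^sup>2) \<partial>gauss \<partial>gauss)
        + ennreal (q\<^sup>2) * (\<integral>\<^sup>+v. \<integral>\<^sup>+w. ennreal ((cmod (F w v))\<^sup>2) \<partial>gauss \<partial>gauss)
     = (\<integral>\<^sup>+v. \<integral>\<^sup>+w. ennreal ((cmod (ladder_fst p q F w v))\<^sup>2) \<partial>gauss \<partial>gauss)
        + ennreal (p\<^sup>2) * (\<integral>\<^sup>+v. \<integral>\<^sup>+w. ennreal ((cmod (F w v))\<^sup>2) \<partial>gauss \<partial>gauss)"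
    (is "?A + _ * ?B = ?C + _ * ?B")
    and "sq_int2 (ladder_fst q p F)"
proof -
  note [measurable] = measurable_gauss_section[OF F(1)]
    measurable_gauss_section[OF sep_entire_ladder_fst[OF F(1), of p q]]
    measurable_gauss_section[OF sep_entire_ladder_fst[OF F(1), of q p]]
  have "AE v in gauss.
      (\<integral>\<^sup>+w. ennreal ((cmod (ladder_fst q p F w v))\<^sup>2) \<partial>gauss) + ennreal (q\<^sup>2) * (\<integral>\<^sup>+w. ennreal ((cmod (F w v))\<^sup>2) \<partial>gauss)
    = (\<integral>\<^sup>+w. ennreal ((cmod (ladder_fst p q F w v))\<^sup>2) \<partial>gauss) + ennreal (p\<^sup>2) * (\<integral>\<^sup>+w. ennreal ((cmod (F w v))\<^sup>2) \<partial>gauss)"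
    using sq_int2_AE[OF F] sq_int2_AE[OF sep_entire_ladder_fst[OF F(1)] L]
  proof eventually_elim
    case (elim v)
    then show ?case
      using gauss_ladder_swap[OF sep_entireD(1)[OF F(1), of v], of p q]
      by (simp add: ladder_fst_def sq_int_def)
  qed
  then have "(\<integral>\<^sup>+v. (\<integral>\<^sup>+w. ennreal ((cmod (ladder_fst q p F w v))\<^sup>2) \<partial>gauss) + ennreal (q\<^sup>2) * (\<integral>\<^sup>+w. ennreal ((cmod (F w v))\<^sup>2) \<partial>gauss) \<partial>gauss)
    = (\<integral>\<^sup>+v. (\<integral>\<^sup>+w. ennreal ((cmod (ladder_fst p q F w v))\<^sup>2) \<partial>gauss) + ennreal (p\<^sup>2) * (\<integral>\<^sup>+w. ennreal ((cmod (F w v))\<^sup>2) \<partial>gauss) \<partial>gauss)"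
    by (rule nn_integral_cong_AE)
  then show eq: "?A + ennreal (q\<^sup>2) * ?B = ?C + ennreal (p\<^sup>2) * ?B"
    by (simp add: nn_integral_add nn_integral_cmult)
  have "?B < \<infinity>" "?C < \<infinity>"
    using F(2) L unfolding sq_int2_iff[OF F(1)] sq_int2_iff[OF sep_entire_ladder_fst[OF F(1)]] .
  then have "?C + ennreal (p\<^sup>2) * ?B < \<infinity>"
    by (simp add: ennreal_mult_less_top)
  then have "?A < \<infinity>"
    unfolding eq[symmetric] by simp
  then show "sq_int2 (ladder_fst q p F)"
    unfolding sq_int2_iff[OF sep_entire_ladder_fst[OF F(1)]] .
qed

lemma gauss_pair_inner:
  assumes F: "sq_int2 F" and G: "sq_int2 G"
  shows "(LINT (v, w)|(gauss \<Otimes>\<^sub>M gauss). F w v * cnj (G w v))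
      = (LINT v|gauss. LINT w|gauss. F w v * cnj (G w v))"
    and "(\<lambda>v. LINT w|gauss. F w v * cnj (G w v)) \<in> borel_measurable gauss"
proof -
  have i: "integrable (gauss \<Otimes>\<^sub>M gauss) (\<lambda>(v, w). F w v * cnj (G w v))"
    using sq_int_prod_integrable[OF F[unfolded sq_int2_def] G[unfolded sq_int2_def]]
    by (simp add: split_beta')
  show "(LINT (v, w)|(gauss \<Otimes>\<^sub>M gauss). F w v * cnj (G w v))
      = (LINT v|gauss. LINT w|gauss. F w v * cnj (G w v))"
    using gauss_pair.integral_fst'[OF i] by simp
  show "(\<lambda>v. LINT w|gauss. F w v * cnj (G w v)) \<in> borel_measurable gauss"
    using gauss_pair.integrable_fst'[OF i] by simp
qed

lemma ladder_fst_adjoint: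
  assumes F: "sep_entire F" "sq_int2 F" and G: "sep_entire G" "sq_int2 G"
    and LF: "sq_int2 (ladder_fst p q F)" and LG: "sq_int2 (ladder_fst q p G)"
  shows "(LINT (v, w)|(gauss \<Otimes>\<^sub>M gauss). ladder_fst p q F w v * cnj (G w v))
      = (LINT (v, w)|(gauss \<Otimes>\<^sub>M gauss). F w v * cnj (ladder_fst q p G w v))"
  unfolding gauss_pair_inner(1)[OF LF G(2)] gauss_pair_inner(1)[OF F(2) LG]
proof (rule integral_cong_AE)
  show "AE v in gauss. (LINT w|gauss. ladder_fst p q F w v * cnj (G w v)) = (LINT w|gauss. F w v * cnj (ladder_fst q p G w v))"
    using sq_int2_AE[OF F] sq_int2_AE[OF G] sq_int2_AE[OF sep_entire_ladder_fst[OF F(1)] LF]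
      sq_int2_AE[OF sep_entire_ladder_fst[OF G(1)] LG]
  proof eventually_elim
    case (elim v)
    then show ?case
      using gauss_ladder_adjoint[OF sep_entireD(1)[OF F(1), of v] _ sep_entireD(1)[OF G(1), of v], of p q]
      by (simp add: ladder_fst_def)
  qed
qed (intro gauss_pair_inner(2) F G LF LG)+

section \<open>Testing against monomials in both variables\<close>

definition fst_coef :: "(complex \<Rightarrow> complex \<Rightarrow> complex) \<Rightarrow> nat \<Rightarrow> complex \<Rightarrow> complex" where
  "fst_coef F n v = tcoef (\<lambda>w. F w v) n"

lemma fst_coef_holomorphic:
  assumes F: "sep_entire F"
  shows "fst_coef F n holomorphic_on UNIV"
proof -
  have "sep_entire (\<lambda>w v. (deriv ^^ n) (\<lambda>w. F w v) w)"
  proof (induction n)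
    case (Suc n)
    from sep_entire_deriv_fst[OF this] show ?case by simp
  qed (simp add: F)
  from sep_entireD(2)[OF this] show ?thesis
    unfolding fst_coef_def[abs_def] tcoef_def by (intro holomorphic_intros) auto
qed

lemma sq_int_fst_coef:
  assumes F: "sep_entire F" "sq_int2 F"
  shows "sq_int gauss (fst_coef F n)"
proof -
  have [measurable]: "fst_coef F n \<in> borel_measurable borel"
    by (intro borel_measurable_continuous_onI holomorphic_on_imp_continuous_on fst_coef_holomorphic F)
  have le: "ennreal ((cmod (fst_coef F n v))\<^sup>2) \<le> (\<integral>\<^sup>+w. ennreal ((cmod (F w v))\<^sup>2) \<partial>gauss)" for v
  proof -
    have "1 \<le> pi * fact n"
      using pi_gt3 fact_ge_1[of n, where ?'a = real] mult_mono[of 1 pi 1 "fact n :: real"] by simp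
    then have "ennreal ((cmod (fst_coef F n v))\<^sup>2) \<le> ennreal (pi * fact n * (cmod (fst_coef F n v))\<^sup>2)"
      by (intro ennreal_leI) (metis mult_right_mono mult_1 zero_le_power2)
    also have "\<dots> = (\<Sum>i\<in>{n}. ennreal (pi * fact i * (cmod (tcoef (\<lambda>w. F w v) i))\<^sup>2))"
      by (simp add: fst_coef_def)
    also have "\<dots> \<le> (\<Sum>i. ennreal (pi * fact i * (cmod (tcoef (\<lambda>w. F w v) i))\<^sup>2))"
      by (rule sum_le_suminf) auto
    also have "\<dots> = (\<integral>\<^sup>+w. ennreal ((cmod (F w v))\<^sup>2) \<partial>gauss)"
      by (rule gauss_parseval[OF sep_entireD(1)[OF F(1)], symmetric])
    finally show ?thesis .
  qed
  have "(\<integral>\<^sup>+v. ennreal ((cmod (fst_coef F n v))\<^sup>2) \<partial>gauss) \<le> (\<integral>\<^sup>+v. \<integral>\<^sup>+w. ennreal ((cmod (F w v))\<^sup>2) \<partial>gauss \<partial>gauss)"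
    by (intro nn_integral_mono le)
  also have "\<dots> < \<infinity>"
    using F(2) unfolding sq_int2_iff[OF F(1)] .
  finally show ?thesis
    by (simp add: sq_int_def)
qed

lemma holomorphic_eq_0_of_monomials:
  assumes \<phi>: "\<phi> holomorphic_on UNIV" "sq_int gauss \<phi>" and "\<And>n. (LINT v|gauss. v ^ n * cnj (\<phi> v)) = 0"
  shows "\<phi> v = 0"
proof -
  have "tcoef \<phi> n = 0" for n
    using gauss_monomial_inner[OF \<phi>, of n] assms(3)[of n] by simp
  then show ?thesis
    using tcoef_sums[OF \<phi>(1), of v] sums_unique2[OF sums_zero, of "\<phi> v"] by simp
qed

lemma ladder_monomial:
  "ladder p q (\<lambda>w. w ^ m) w = of_real p * (of_nat m * w ^ (m - 1)) + of_real q * w ^ Suc m"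
proof -
  have "deriv (\<lambda>w. w ^ m) w = of_nat m * w ^ (m - 1)"
    by (rule DERIV_imp_deriv) (auto intro!: derivative_eq_intros)
  then show ?thesis by (simp add: ladder_def)
qed

lemma sq_int_ladder_monomial: "sq_int gauss (ladder p q (\<lambda>w. w ^ m))"
  unfolding ladder_monomial[abs_def] by (intro sq_int_add sq_int_cmult sq_int_monomial)

lemma gauss_ladder_monomial_inner:
  assumes g: "g holomorphic_on UNIV" "sq_int gauss g"
  shows "(LINT w|gauss. ladder p q (\<lambda>w. w ^ m) w * cnj (g w))
    = of_real (pi * fact m) * cnj (ladder_seq q p (tcoef g) m)"
proof -
  have int: "integrable gauss (\<lambda>w. w ^ n * cnj (g w))" for n
    by (intro sq_int_prod_integrable sq_int_monomial g)
  have "(LINT w|gauss. ladder p q (\<lambda>w. w ^ m) w * cnj (g w))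
     = (LINT w|gauss. (of_real p * of_nat m) * (w ^ (m - 1) * cnj (g w)) + of_real q * (w ^ Suc m * cnj (g w)))"
    unfolding ladder_monomial by (intro Bochner_Integration.integral_cong) (simp_all add: algebra_simps)
  also have "\<dots> = (of_real p * of_nat m) * (LINT w|gauss. w ^ (m - 1) * cnj (g w)) + of_real q * (LINT w|gauss. w ^ Suc m * cnj (g w))"
    by (subst Bochner_Integration.integral_add, intro integrable_mult_right int, intro integrable_mult_right int)
       (simp only: integral_mult_right_zero)
  also have "\<dots> = of_real (pi * fact m) * cnj (ladder_seq q p (tcoef g) m)"
    unfolding gauss_monomial_inner[OF g] ladder_seq_def
    by (cases m) (simp_all add: algebra_simps)
  finally show ?thesis .
qed

lemma ladder_fst_monomial:
  "ladder_fst p q (\<lambda>w v. w ^ m * v ^ n) w v = ladder p q (\<lambda>w. w ^ m) w * v ^ n"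
proof -
  have "deriv (\<lambda>w. w ^ m * v ^ n) w = deriv (\<lambda>w. w ^ m) w * v ^ n"
    by (rule deriv_cmult_right) (intro derivative_intros)
  then show ?thesis
    by (simp add: ladder_fst_def ladder_def algebra_simps)
qed

lemma sq_int2_mult_monomial:
  assumes f: "f holomorphic_on UNIV" "sq_int gauss f"
  shows "sq_int2 (\<lambda>w v. f w * v ^ n)"
proof -
  have se: "sep_entire (\<lambda>w v. f w * v ^ n)"
    by (intro sep_entire_mult sep_entire_of_fst[OF f(1)] sep_entire_flip[OF sep_entire_of_fst] holomorphic_intros)
  have [measurable]: "f \<in> borel_measurable borel"
    by (intro borel_measurable_continuous_onI holomorphic_on_imp_continuous_on f)
  have "(\<integral>\<^sup>+v. \<integral>\<^sup>+w. ennreal ((cmod (f w * v ^ n))\<^sup>2) \<partial>gauss \<partial>gauss)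
      = (\<integral>\<^sup>+v. ennreal ((cmod (v ^ n))\<^sup>2) * (\<integral>\<^sup>+w. ennreal ((cmod (f w))\<^sup>2) \<partial>gauss) \<partial>gauss)"
  proof (rule nn_integral_cong)
    fix v
    show "(\<integral>\<^sup>+w. ennreal ((cmod (f w * v ^ n))\<^sup>2) \<partial>gauss)
        = ennreal ((cmod (v ^ n))\<^sup>2) * (\<integral>\<^sup>+w. ennreal ((cmod (f w))\<^sup>2) \<partial>gauss)"
      by (subst nn_integral_cmult[symmetric]) (simp_all add: norm_mult power_mult_distrib ennreal_mult mult.commute)
  qed
  also have "\<dots> = (\<integral>\<^sup>+v. ennreal ((cmod (v ^ n))\<^sup>2) \<partial>gauss) * (\<integral>\<^sup>+w. ennreal ((cmod (f w))\<^sup>2) \<partial>gauss)"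
    by (rule nn_integral_multc) simp
  also have "\<dots> < \<infinity>"
    using f(2) sq_int_monomial[of n] by (simp add: sq_int_def ennreal_mult_less_top)
  finally show ?thesis
    unfolding sq_int2_iff[OF se] .
qed

lemma sq_int2_monomial: "sq_int2 (\<lambda>w v. w ^ m * v ^ n)"
  by (intro sq_int2_mult_monomial sq_int_monomial holomorphic_intros)

lemma sq_int2_ladder_monomial: "sq_int2 (ladder_fst p q (\<lambda>w v. w ^ m * v ^ n))"
  unfolding ladder_fst_monomial[abs_def]
  by (intro sq_int2_mult_monomial sq_int_ladder_monomial ladder_holomorphic holomorphic_intros)

text \<open>It is not known that \<open>ladder_fst q p G\<close> is square integrable, so it cannot
  be paired with test functions directly. A monomial \<open>w ^ m\<close>, however, sees only the
  coefficient of order \<open>m\<close>, which involves finitely many coefficient functions of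
  \<open>G\<close>, and each of those is square integrable in \<open>v\<close>.\<close>

lemma ladder_fst_adjoint_unique:
  assumes G: "sep_entire G" "sq_int2 G" and H: "sep_entire H" "sq_int2 H"
    and eq: "\<And>m n. (LINT (v, w)|(gauss \<Otimes>\<^sub>M gauss). ladder_fst p q (\<lambda>w v. w ^ m * v ^ n) w v * cnj (G w v))
      = (LINT (v, w)|(gauss \<Otimes>\<^sub>M gauss). (w ^ m * v ^ n) * cnj (H w v))"
  shows "H w v = ladder_fst q p G w v"
proof -
  have "ladder_seq q p (tcoef (\<lambda>w. G w v)) m - tcoef (\<lambda>w. H w v) m = 0" for m v
  proof -
    \<comment> \<open>The coefficient of \<open>w ^ m\<close> in the difference to be shown zero, as
      a function of \<open>v\<close>. Pairing with \<open>w ^ m\<close> isolates it, and then the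
      powers \<open>v ^ n\<close> show that it vanishes.\<close>
    define \<phi> where "\<phi> v = ladder_seq q p (tcoef (\<lambda>w. G w v)) m - tcoef (\<lambda>w. H w v) m" for v
    have \<phi>_eq: "\<phi> = (\<lambda>v. of_real q * (of_nat (Suc m) * fst_coef G (Suc m) v)
        + of_real p * (case m of 0 \<Rightarrow> 0 | Suc i \<Rightarrow> fst_coef G i v) + (-1) * fst_coef H m v)"
      by (simp add: \<phi>_def ladder_seq_def fst_coef_def fun_eq_iff split: nat.split)
    have \<phi>: "\<phi> holomorphic_on UNIV" "sq_int gauss \<phi>"
    proof -
      have "(\<lambda>v. case m of 0 \<Rightarrow> 0 | Suc i \<Rightarrow> fst_coef G i v) holomorphic_on UNIV"
        by (cases m) (auto intro: fst_coef_holomorphic G)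
      then show "\<phi> holomorphic_on UNIV"
        unfolding \<phi>_eq by (intro holomorphic_intros fst_coef_holomorphic G H)
      have "sq_int gauss (\<lambda>v. case m of 0 \<Rightarrow> 0 | Suc i \<Rightarrow> fst_coef G i v)"
      proof (cases m)
        case (Suc i)
        with sq_int_fst_coef[OF G, of i] show ?thesis by simp
      qed (simp add: sq_int_def)
      then show "sq_int gauss \<phi>"
        unfolding \<phi>_eq by (intro sq_int_add sq_int_cmult sq_int_fst_coef G H)
    qed
    have "(LINT v|gauss. v ^ n * cnj (\<phi> v)) = 0" for n
    proof -
      have holm: "(\<lambda>w. w ^ m) holomorphic_on UNIV" for m :: nat
        by (intro holomorphic_intros)
      have s1: "sq_int2 (\<lambda>w v. ladder p q (\<lambda>w. w ^ m) w * v ^ n)" "sq_int2 (\<lambda>w v. w ^ m * v ^ n)"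
        by (intro sq_int2_mult_monomial ladder_holomorphic holm sq_int_monomial sq_int_ladder_monomial)+
      have m1: "(\<lambda>v. LINT w|gauss. (ladder p q (\<lambda>w. w ^ m) w * v ^ n) * cnj (G w v)) \<in> borel_measurable gauss"
        by (rule gauss_pair_inner(2)[OF s1(1) G(2)])
      have m2: "(\<lambda>v. LINT w|gauss. (w ^ m * v ^ n) * cnj (H w v)) \<in> borel_measurable gauss"
        by (rule gauss_pair_inner(2)[OF s1(2) H(2)])
      have "0 = (LINT v|gauss. LINT w|gauss. (ladder p q (\<lambda>w. w ^ m) w * v ^ n) * cnj (G w v))
          - (LINT v|gauss. LINT w|gauss. (w ^ m * v ^ n) * cnj (H w v))"
        using eq[of m n] unfolding ladder_fst_monomial gauss_pair_inner(1)[OF s1(1) G(2)] gauss_pair_inner(1)[OF s1(2) H(2)] by simp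
      also have "\<dots> = (LINT v|gauss. of_real (pi * fact m) * (v ^ n * cnj (ladder_seq q p (tcoef (\<lambda>w. G w v)) m)))
          - (LINT v|gauss. of_real (pi * fact m) * (v ^ n * cnj (tcoef (\<lambda>w. H w v) m)))"
      proof (intro arg_cong2[where f = "(-)"] integral_cong_AE m1 m2)
        \<comment> \<open>Seen as a coefficient function of an entire function, this expression is
          continuous in \<open>v\<close>, hence measurable.\<close>
        have "ladder_seq q p (tcoef (\<lambda>w. G w v)) m = fst_coef (ladder_fst q p G) m v" for v
          by (simp add: fst_coef_def ladder_fst_def[abs_def] tcoef_ladder[OF sep_entireD(1)[OF G(1)]])
        moreover have "(\<lambda>v. of_real (pi * fact m) * (v ^ n * cnj (fst_coef K m v))) \<in> borel_measurable gauss" if "sep_entire K" for K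
        proof -
          have "(\<lambda>v. of_real (pi * fact m) * (v ^ n * cnj (fst_coef K m v))) \<in> borel_measurable borel"
            by (intro borel_measurable_continuous_onI continuous_intros holomorphic_on_imp_continuous_on fst_coef_holomorphic that)
          then show ?thesis by simp
        qed
        ultimately show "(\<lambda>v. of_real (pi * fact m) * (v ^ n * cnj (ladder_seq q p (tcoef (\<lambda>w. G w v)) m))) \<in> borel_measurable gauss"
          "(\<lambda>v. of_real (pi * fact m) * (v ^ n * cnj (tcoef (\<lambda>w. H w v) m))) \<in> borel_measurable gauss"
          using sep_entire_ladder_fst[OF G(1)] H(1) by (auto simp: fst_coef_def[symmetric])
        show "AE v in gauss. (LINT w|gauss. (ladder p q (\<lambda>w. w ^ m) w * v ^ n) * cnj (G w v))
            = of_real (pi * fact m) * (v ^ n * cnj (ladder_seq q p (tcoef (\<lambda>w. G w v)) m))"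
          using sq_int2_AE[OF G]
        proof eventually_elim
          case (elim v)
          have "(LINT w|gauss. (ladder p q (\<lambda>w. w ^ m) w * v ^ n) * cnj (G w v))
              = (LINT w|gauss. v ^ n * (ladder p q (\<lambda>w. w ^ m) w * cnj (G w v)))"
            by (simp add: mult_ac)
          also have "\<dots> = v ^ n * (of_real (pi * fact m) * cnj (ladder_seq q p (tcoef (\<lambda>w. G w v)) m))"
            unfolding integral_mult_right_zero gauss_ladder_monomial_inner[OF sep_entireD(1)[OF G(1)] elim] ..
          finally show ?case by (simp add: mult_ac)
        qed
        show "AE v in gauss. (LINT w|gauss. (w ^ m * v ^ n) * cnj (H w v))
            = of_real (pi * fact m) * (v ^ n * cnj (tcoef (\<lambda>w. H w v) m))"
          using sq_int2_AE[OF H]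
        proof eventually_elim
          case (elim v)
          have "(LINT w|gauss. (w ^ m * v ^ n) * cnj (H w v)) = (LINT w|gauss. v ^ n * (w ^ m * cnj (H w v)))"
            by (simp add: mult_ac)
          also have "\<dots> = v ^ n * (of_real (pi * fact m) * cnj (tcoef (\<lambda>w. H w v) m))"
            unfolding integral_mult_right_zero gauss_monomial_inner[OF sep_entireD(1)[OF H(1)] elim] ..
          finally show ?case by (simp add: mult_ac)
        qed
      qed
      also have "\<dots> = of_real (pi * fact m) * (LINT v|gauss. v ^ n * cnj (\<phi> v))"
      proof -
        have i1: "integrable gauss (\<lambda>v. v ^ n * cnj (fst_coef H m v))"
          by (intro sq_int_prod_integrable sq_int_monomial sq_int_fst_coef H)
        have i2: "integrable gauss (\<lambda>v. v ^ n * cnj (\<phi> v))"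
          by (intro sq_int_prod_integrable sq_int_monomial \<phi>)
        \<comment> \<open>The coefficient of \<open>ladder_fst q p G\<close> is the sum of
          \<open>\<phi>\<close> and that of \<open>H\<close>, both already square
          integrable.\<close>
        have i3: "integrable gauss (\<lambda>v. v ^ n * cnj (ladder_seq q p (tcoef (\<lambda>w. G w v)) m))"
          using Bochner_Integration.integrable_add[OF i1 i2]
          by (simp add: \<phi>_def fst_coef_def algebra_simps)
        have d: "(LINT v|gauss. v ^ n * cnj (\<phi> v)) = (LINT v|gauss. v ^ n * cnj (ladder_seq q p (tcoef (\<lambda>w. G w v)) m))
            - (LINT v|gauss. v ^ n * cnj (tcoef (\<lambda>w. H w v) m))"
          using Bochner_Integration.integral_diff[OF i3 i1]
          by (simp add: \<phi>_def fst_coef_def right_diff_distrib)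
        show ?thesis
          unfolding integral_mult_right_zero right_diff_distrib[symmetric]
          by (simp only: d)
      qed
      finally show ?thesis by simp
    qed
    from holomorphic_eq_0_of_monomials[OF \<phi> this] show ?thesis
      unfolding \<phi>_def .
  qed
  then have *: "tcoef (\<lambda>w. H w v) = tcoef (ladder q p (\<lambda>w. G w v))"
    by (auto simp: fun_eq_iff tcoef_ladder[OF sep_entireD(1)[OF G(1)]])
  have "(\<lambda>n. tcoef (\<lambda>w. H w v) n * w ^ n) sums H w v"
    by (rule tcoef_sums[OF sep_entireD(1)[OF H(1)]])
  moreover have "(\<lambda>n. tcoef (\<lambda>w. H w v) n * w ^ n) sums ladder q p (\<lambda>w. G w v) w"
    unfolding * by (intro tcoef_sums ladder_holomorphic sep_entireD(1)[OF G(1)])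
  ultimately show ?thesis
    unfolding ladder_fst_def by (rule sums_unique2)
qed

section \<open>The weighted space and its operators\<close>

definition dress :: "real ^ 2 \<Rightarrow> complex ^ 2 \<Rightarrow> complex" where
  "dress \<beta> z = exp (- (of_real (\<beta> $ 1) * (z $ 1)\<^sup>2 + of_real (\<beta> $ 2) * (z $ 2)\<^sup>2) / 2)"

text \<open>The image of \<open>f\<close> in the Fock space, in coordinates where the first argument
  is the active variable \<open>z $ j\<close>.\<close>

definition fock :: "real ^ 2 \<Rightarrow> 2 \<Rightarrow> 2 \<Rightarrow> cfun \<Rightarrow> complex \<Rightarrow> complex \<Rightarrow> complex" where
  "fock \<beta> j k f = slice j k (\<lambda>z. f z * dress \<beta> z)"

lemma dress_nz [simp]: "dress \<beta> z \<noteq> 0"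
  by (simp add: dress_def)

lemma sum_2_eq: "j \<noteq> (k::2) \<Longrightarrow> g 1 + g 2 = (g j + g k :: 'a::comm_monoid_add)"
  using exhaust_2[of j] exhaust_2[of k] by (auto simp: add.commute)

lemma slice_dress:
  assumes "j \<noteq> k"
  shows "slice j k (dress \<beta>) w v = exp (- (of_real (\<beta> $ j) * w\<^sup>2 + of_real (\<beta> $ k) * v\<^sup>2) / 2)"
  using assms unfolding slice_def dress_def
    sum_2_eq[OF assms, of "\<lambda>i. of_real (\<beta> $ i) * ((axis j w + axis k v) $ i)\<^sup>2"]
  by (simp add: axis_def)

lemma cmod_dress_weight:
  "weight \<beta> z = (cmod (dress \<beta> z))\<^sup>2 * exp (- ((cmod (z $ 1))\<^sup>2 + (cmod (z $ 2))\<^sup>2))"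
proof -
  have "(cmod (dress \<beta> z))\<^sup>2 = exp (- Re (of_real (\<beta> $ 1) * (z $ 1)\<^sup>2 + of_real (\<beta> $ 2) * (z $ 2)\<^sup>2))"
    unfolding dress_def norm_exp_eq_Re exp_double[symmetric] by (rule arg_cong[where f = exp]) simp
  then show ?thesis
    by (simp add: weight_def exp_add[symmetric])
qed

lemma slice_mult: "slice j k (\<lambda>z. f z * g z) w v = slice j k f w v * slice j k g w v"
  by (simp add: slice_def)

lemma sep_entire_slice_dress:
  assumes "j \<noteq> k"
  shows "sep_entire (slice j k (dress \<beta>))"
proof -
  have "sep_entire (\<lambda>w v. exp (- (of_real (\<beta> $ j) * w\<^sup>2 + of_real (\<beta> $ k) * v\<^sup>2) / 2))"
    by (intro sep_entireI continuous_intros holomorphic_intros) auto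
  then show ?thesis
    by (simp add: slice_dress[OF assms, abs_def])
qed

lemma entire2_dress: "entire2 (dress \<beta>)"
  unfolding entire2_slice_12 by (rule sep_entire_slice_dress) simp

lemma sep_entire_fock:
  assumes "j \<noteq> k" "entire2 f"
  shows "sep_entire (fock \<beta> j k f)"
  unfolding fock_def slice_mult[abs_def]
  using assms sep_entire_slice_dress[OF assms(1)] entire2_slice[OF assms(1)] by (intro sep_entire_mult) auto

lemma entire2_add: "entire2 f \<Longrightarrow> entire2 g \<Longrightarrow> entire2 (\<lambda>z. f z + g z)"
  and entire2_mult: "entire2 f \<Longrightarrow> entire2 g \<Longrightarrow> entire2 (\<lambda>z. f z * g z)"
  using sep_entire_add[of "slice 1 2 f" "slice 1 2 g"] sep_entire_mult[of "slice 1 2 f" "slice 1 2 g"]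
  by (simp_all add: entire2_slice_12 slice_def[abs_def])

lemma entire2_const: "entire2 (\<lambda>z. c)"
  using sep_entire_const[of c] by (simp add: entire2_slice_12 slice_def[abs_def])

lemma entire2_coord: "entire2 (\<lambda>z. z $ j)"
proof (cases "j = 1")
  case True
  then show ?thesis
    using sep_entire_fst by (simp add: entire2_slice_12 slice_def[abs_def] axis_def)
next
  case False
  then have "j = 2" using exhaust_2[of j] by simp
  then show ?thesis
    using sep_entire_snd by (simp add: entire2_slice_12 slice_def[abs_def] axis_def)
qed

lemma entire2_continuous:
  assumes "entire2 f"
  shows "continuous_on UNIV f"
proof -
  have "continuous_on UNIV (\<lambda>z :: complex ^ 2. slice 1 2 f (z $ 1) (z $ 2))"
    by (intro continuous_on_sep_entire[OF assms[unfolded entire2_slice_12]] continuous_intros)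
  then show ?thesis
    by (simp add: slice_inverse)
qed

lemma dress_continuous: "continuous_on UNIV (dress \<beta>)"
  unfolding dress_def[abs_def] by (intro continuous_intros) auto

lemma axis_pair_continuous: "continuous_on UNIV (\<lambda>(v, w). axis j w + axis k v :: complex ^ 2)"
proof -
  have *: "continuous_on UNIV (axis i :: complex \<Rightarrow> complex ^ 2)" for i
    using axis_has_derivative by (auto simp: continuous_on_eq_continuous_at intro!: has_derivative_continuous)
  have "continuous_on UNIV (\<lambda>p. axis j (snd p) :: complex ^ 2)" "continuous_on UNIV (\<lambda>p. axis k (fst p) :: complex ^ 2)"
    by (rule continuous_on_compose2[OF *[of j] continuous_on_snd[OF continuous_on_id]], simp)
       (rule continuous_on_compose2[OF *[of k] continuous_on_fst[OF continuous_on_id]], simp)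
  then show ?thesis
    unfolding case_prod_unfold by (rule continuous_on_add)
qed

section \<open>Transfer of integrals to the Gaussian product measure\<close>

lemma gauss_pair_distr:
  assumes "j \<noteq> k"
  shows "distr (gauss \<Otimes>\<^sub>M gauss) borel (\<lambda>(v, w). axis j w + axis k v)
    = density lborel (\<lambda>z::complex ^ 2. ennreal (exp (- ((cmod (z $ 1))\<^sup>2 + (cmod (z $ 2))\<^sup>2))))"
proof -
  let ?T = "\<lambda>(v, w). axis j w + axis k v :: complex ^ 2"
  let ?g = "\<lambda>z::complex. ennreal (exp (- (cmod z)\<^sup>2))"
  let ?G = "\<lambda>z::complex ^ 2. ennreal (exp (- ((cmod (z $ 1))\<^sup>2 + (cmod (z $ 2))\<^sup>2)))"
  have T: "?T \<in> borel_measurable (lborel \<Otimes>\<^sub>M lborel)"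
    using borel_measurable_continuous_onI[OF axis_pair_continuous] by (simp add: lborel_prod)
  have G: "?G \<in> borel_measurable borel"
    by (intro measurable_compose[OF _ measurable_ennreal] borel_measurable_continuous_onI continuous_intros)
  have "gauss \<Otimes>\<^sub>M gauss = density (lborel \<Otimes>\<^sub>M lborel) (\<lambda>(v, w). ?g v * ?g w)"
    unfolding gauss_def
    by (rule pair_measure_density)
       (auto simp: gauss_def[symmetric] intro: lborel.sigma_finite_measure_axioms gauss.sigma_finite_measure_axioms)
  also have "(\<lambda>(v, w). ?g v * ?g w) = (\<lambda>p. ?G (?T p))"
  proof
    fix p :: "complex \<times> complex"
    have "(cmod (?T p $ 1))\<^sup>2 + (cmod (?T p $ 2))\<^sup>2 = (cmod (?T p $ j))\<^sup>2 + (cmod (?T p $ k))\<^sup>2"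
      by (rule sum_2_eq[OF assms])
    also have "\<dots> = (cmod (snd p))\<^sup>2 + (cmod (fst p))\<^sup>2"
      using assms by (simp add: axis_def split_beta)
    finally have "?G (?T p) = ennreal (exp (- ((cmod (snd p))\<^sup>2 + (cmod (fst p))\<^sup>2)))"
      by simp
    then show "(case p of (v, w) \<Rightarrow> ?g v * ?g w) = ?G (?T p)"
      by (simp add: split_beta ennreal_mult[symmetric] exp_add[symmetric])
  qed
  finally have "distr (gauss \<Otimes>\<^sub>M gauss) borel ?T = distr (density (lborel \<Otimes>\<^sub>M lborel) (\<lambda>p. ?G (?T p))) borel ?T"
    by simp
  also have "\<dots> = density (distr (lborel \<Otimes>\<^sub>M lborel) borel ?T) ?G"
    by (rule density_distr[OF G T, symmetric])
  \<comment> \<open>Here pairs carry the active variable second, so the indices are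
    exchanged.\<close>
  also have "distr (lborel \<Otimes>\<^sub>M lborel) borel ?T = lborel"
    using lborel_axis_pair[of k j] assms by (simp add: add.commute)
  finally show ?thesis .
qed

lemma axis_pair_measurable: "(\<lambda>(v, w). axis j w + axis k v :: complex ^ 2) \<in> borel_measurable (gauss \<Otimes>\<^sub>M gauss)"
  by (rule measurable_gauss_pair[OF axis_pair_continuous])

lemma gauss_pair_transfer:
  fixes f :: "complex ^ 2 \<Rightarrow> 'b::{banach, second_countable_topology}"
  assumes jk: "j \<noteq> k" and f: "continuous_on UNIV f"
  shows "integrable lborel (\<lambda>z. exp (- ((cmod (z $ 1))\<^sup>2 + (cmod (z $ 2))\<^sup>2)) *\<^sub>R f z)
      \<longleftrightarrow> integrable (gauss \<Otimes>\<^sub>M gauss) (\<lambda>(v, w). f (axis j w + axis k v))" (is ?i)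
    and "(LINT z|lborel. exp (- ((cmod (z $ 1))\<^sup>2 + (cmod (z $ 2))\<^sup>2)) *\<^sub>R f z)
      = (LINT (v, w)|(gauss \<Otimes>\<^sub>M gauss). f (axis j w + axis k v))" (is ?e)
proof -
  let ?g = "\<lambda>z::complex ^ 2. exp (- ((cmod (z $ 1))\<^sup>2 + (cmod (z $ 2))\<^sup>2))"
  have f': "f \<in> borel_measurable borel"
    by (rule borel_measurable_continuous_onI[OF f])
  have g: "?g \<in> borel_measurable lborel"
    using borel_measurable_continuous_onI[of ?g] by (simp add: continuous_intros)
  let ?T = "\<lambda>(v, w). axis j w + axis k v :: complex ^ 2"
  have "integrable lborel (\<lambda>z. ?g z *\<^sub>R f z) \<longleftrightarrow> integrable (density lborel ?g) f"
    using f' g by (intro integrable_density[symmetric]) auto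
  also have "\<dots> \<longleftrightarrow> integrable (distr (gauss \<Otimes>\<^sub>M gauss) borel ?T) f"
    unfolding gauss_pair_distr[OF jk] ..
  also have "\<dots> \<longleftrightarrow> integrable (gauss \<Otimes>\<^sub>M gauss) (\<lambda>(v, w). f (axis j w + axis k v))"
    using integrable_distr_eq[OF axis_pair_measurable f', of j k] by (simp add: split_beta')
  finally show ?i .
  have "(LINT z|lborel. ?g z *\<^sub>R f z) = integral\<^sup>L (density lborel ?g) f"
    using f' g by (intro integral_density[symmetric]) auto
  also have "\<dots> = integral\<^sup>L (distr (gauss \<Otimes>\<^sub>M gauss) borel ?T) f"
    unfolding gauss_pair_distr[OF jk] ..
  also have "\<dots> = (LINT (v, w)|(gauss \<Otimes>\<^sub>M gauss). f (axis j w + axis k v))"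
    using integral_distr[OF axis_pair_measurable f', of j k] by (simp add: split_beta')
  finally show ?e .
qed

lemma fock_apply: "fock \<beta> j k f w v = f (axis j w + axis k v) * dress \<beta> (axis j w + axis k v)"
  by (simp add: fock_def slice_def)

lemma HA_norm_fock:
  assumes jk: "j \<noteq> k" and f: "entire2 f"
  shows "f \<in> HA \<beta> \<longleftrightarrow> sq_int2 (fock \<beta> j k f)"
    and "(HA_norm \<beta> f)\<^sup>2 = (LINT (v, w)|(gauss \<Otimes>\<^sub>M gauss). (cmod (fock \<beta> j k f w v))\<^sup>2)"
proof -
  have c: "continuous_on UNIV (\<lambda>z. (cmod (f z * dress \<beta> z))\<^sup>2)"
    by (intro continuous_intros entire2_continuous f dress_continuous)
  have w: "(cmod (f z))\<^sup>2 * weight \<beta> z = exp (- ((cmod (z $ 1))\<^sup>2 + (cmod (z $ 2))\<^sup>2)) *\<^sub>R (cmod (f z * dress \<beta> z))\<^sup>2" for z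
    by (simp add: cmod_dress_weight norm_mult power_mult_distrib)
  have m: "(\<lambda>(v, w). fock \<beta> j k f w v) \<in> borel_measurable (gauss \<Otimes>\<^sub>M gauss)"
    by (rule sep_entire_measurable[OF sep_entire_fock[OF jk f]])
  have "sq_int2 (fock \<beta> j k f) \<longleftrightarrow> integrable (gauss \<Otimes>\<^sub>M gauss) (\<lambda>(v, w). (cmod (fock \<beta> j k f w v))\<^sup>2)"
    using sq_intD(2)[of "gauss \<Otimes>\<^sub>M gauss" "\<lambda>(v, w). fock \<beta> j k f w v"] sq_intI[OF m]
    unfolding sq_int2_def case_prod_unfold by blast
  also have "\<dots> \<longleftrightarrow> f \<in> HA \<beta>"
    using gauss_pair_transfer(1)[OF jk c] f by (simp add: HA_def w fock_apply)
  finally show "f \<in> HA \<beta> \<longleftrightarrow> sq_int2 (fock \<beta> j k f)" ..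
  have "(HA_norm \<beta> f)\<^sup>2 = (LINT z|lborel. (cmod (f z))\<^sup>2 * weight \<beta> z)"
    unfolding HA_norm_def by (intro real_sqrt_pow2 integral_nonneg_AE) (auto simp: weight_def)
  then show "(HA_norm \<beta> f)\<^sup>2 = (LINT (v, w)|(gauss \<Otimes>\<^sub>M gauss). (cmod (fock \<beta> j k f w v))\<^sup>2)"
    using gauss_pair_transfer(2)[OF jk c] by (simp add: w fock_apply)
qed

lemma HA_inner_fock:
  assumes jk: "j \<noteq> k" and f: "entire2 f" and g: "entire2 g"
  shows "HA_inner \<beta> f g = (LINT (v, w)|(gauss \<Otimes>\<^sub>M gauss). fock \<beta> j k f w v * cnj (fock \<beta> j k g w v))"
proof -
  have c: "continuous_on UNIV (\<lambda>z. (f z * dress \<beta> z) * cnj (g z * dress \<beta> z))"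
    by (intro continuous_intros entire2_continuous f g dress_continuous)
  have w: "f z * cnj (g z) * complex_of_real (weight \<beta> z)
      = exp (- ((cmod (z $ 1))\<^sup>2 + (cmod (z $ 2))\<^sup>2)) *\<^sub>R ((f z * dress \<beta> z) * cnj (g z * dress \<beta> z))" for z
    unfolding cmod_dress_weight of_real_mult complex_norm_square scaleR_conv_of_real
    by (simp add: mult_ac)
  show ?thesis
    unfolding HA_inner_def w using gauss_pair_transfer(2)[OF jk c] by (simp only: fock_apply)
qed

text \<open>The coefficient \<open>q - p \<beta>\<^sub>j\<close> makes this the conjugate of \<open>p D + q M\<close> under the multiplication by
  \<open>dress \<beta>\<close>, since \<open>\<partial>\<^sub>j (dress \<beta>) = - \<beta>\<^sub>j z\<^sub>j dress \<beta>\<close>.\<close>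
definition ladder_op :: "real ^ 2 \<Rightarrow> 2 \<Rightarrow> real \<Rightarrow> real \<Rightarrow> cfun \<Rightarrow> cfun" where
  "ladder_op \<beta> j p q f z = of_real p * partial_deriv j f z + of_real (q - p * \<beta> $ j) * (z $ j * f z)"

lemma entire2_ladder_op: "entire2 f \<Longrightarrow> entire2 (ladder_op \<beta> j p q f)"
  unfolding ladder_op_def[abs_def]
  by (intro entire2_add entire2_mult entire2_const entire2_coord entire2_partial_deriv)

lemma fock_ladder_op:
  assumes jk: "j \<noteq> k" and f: "entire2 f"
  shows "fock \<beta> j k (ladder_op \<beta> j p q f) = ladder_fst p q (fock \<beta> j k f)"
proof (intro ext)
  fix w v :: complex
  let ?D = "\<lambda>w. exp (- (of_real (\<beta> $ j) * w\<^sup>2 + of_real (\<beta> $ k) * v\<^sup>2) / 2)"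
  have "((\<lambda>w. slice j k f w v) has_field_derivative deriv (\<lambda>w. slice j k f w v) w) (at w)"
    using f entire2_slice[OF jk] by (intro holomorphic_derivI[of _ UNIV] sep_entireD(1)) auto
  then have "((\<lambda>w. slice j k f w v * ?D w) has_field_derivative
      deriv (\<lambda>w. slice j k f w v) w * ?D w - of_real (\<beta> $ j) * w * slice j k f w v * ?D w) (at w)"
    by (auto intro!: derivative_eq_intros simp: field_simps)
  then have der: "deriv (\<lambda>w. slice j k f w v * ?D w) w
      = deriv (\<lambda>w. slice j k f w v) w * ?D w - of_real (\<beta> $ j) * w * slice j k f w v * ?D w"
    by (rule DERIV_imp_deriv)
  have sl: "slice j k (ladder_op \<beta> j p q f) w v
      = of_real p * slice j k (partial_deriv j f) w v + of_real (q - p * \<beta> $ j) * (w * slice j k f w v)"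
    using jk by (simp add: slice_def ladder_op_def axis_def)
  show "fock \<beta> j k (ladder_op \<beta> j p q f) w v = ladder_fst p q (fock \<beta> j k f) w v"
    unfolding ladder_fst_def ladder_def fock_def slice_mult slice_dress[OF jk] der sl slice_partial_fst
    by (simp add: algebra_simps)
qed

lemma HA_entire: "f \<in> HA \<beta> \<Longrightarrow> entire2 f"
  by (simp add: HA_def)

lemma HA_ladder_swap:
  assumes f: "f \<in> HA \<beta>" and L: "ladder_op \<beta> j p q f \<in> HA \<beta>"
  shows "ladder_op \<beta> j q p f \<in> HA \<beta>"
    and "(HA_norm \<beta> (ladder_op \<beta> j q p f))\<^sup>2 + q\<^sup>2 * (HA_norm \<beta> f)\<^sup>2
       = (HA_norm \<beta> (ladder_op \<beta> j p q f))\<^sup>2 + p\<^sup>2 * (HA_norm \<beta> f)\<^sup>2"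
proof -
  obtain k where jk: "j \<noteq> k" using ex_other by blast
  note e = HA_entire[OF f]
  note F = sep_entire_fock[OF jk e, of \<beta>] f[unfolded HA_norm_fock(1)[OF jk e]]
  note L' = L[unfolded HA_norm_fock(1)[OF jk entire2_ladder_op[OF e]] fock_ladder_op[OF jk e]]
  note swap = ladder_fst_swap[OF F L']
  show L2: "ladder_op \<beta> j q p f \<in> HA \<beta>"
    unfolding HA_norm_fock(1)[OF jk entire2_ladder_op[OF e]] fock_ladder_op[OF jk e] by (rule swap(2))
  have N: "(\<integral>\<^sup>+v. \<integral>\<^sup>+w. ennreal ((cmod (fock \<beta> j k g w v))\<^sup>2) \<partial>gauss \<partial>gauss) = ennreal ((HA_norm \<beta> g)\<^sup>2)"
    if g: "g \<in> HA \<beta>" for g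
  proof -
    note eg = HA_entire[OF g]
    have "(\<integral>\<^sup>+v. \<integral>\<^sup>+w. ennreal ((cmod (fock \<beta> j k g w v))\<^sup>2) \<partial>gauss \<partial>gauss)
        = (\<integral>\<^sup>+(v, w). ennreal ((cmod (fock \<beta> j k g w v))\<^sup>2) \<partial>(gauss \<Otimes>\<^sub>M gauss))"
      by (rule nn_integral_gauss_pair[OF sep_entire_fock[OF jk eg], symmetric])
    also have "\<dots> = ennreal ((HA_norm \<beta> g)\<^sup>2)"
      using sq_intD(3)[OF g[unfolded HA_norm_fock(1)[OF jk eg] sq_int2_def]]
      unfolding HA_norm_fock(2)[OF jk eg] case_prod_unfold .
    finally show ?thesis .
  qed
  have "ennreal ((HA_norm \<beta> (ladder_op \<beta> j q p f))\<^sup>2 + q\<^sup>2 * (HA_norm \<beta> f)\<^sup>2)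
      = ennreal ((HA_norm \<beta> (ladder_op \<beta> j p q f))\<^sup>2 + p\<^sup>2 * (HA_norm \<beta> f)\<^sup>2)"
    using swap(1) unfolding fock_ladder_op[OF jk e, symmetric] N[OF f] N[OF L] N[OF L2]
    by (simp flip: ennreal_mult ennreal_plus)
  then show "(HA_norm \<beta> (ladder_op \<beta> j q p f))\<^sup>2 + q\<^sup>2 * (HA_norm \<beta> f)\<^sup>2
       = (HA_norm \<beta> (ladder_op \<beta> j p q f))\<^sup>2 + p\<^sup>2 * (HA_norm \<beta> f)\<^sup>2"
    by (subst (asm) ennreal_inj) auto
qed

lemma HA_ladder_adjoint:
  assumes f: "f \<in> HA \<beta>" "ladder_op \<beta> j p q f \<in> HA \<beta>" and g: "g \<in> HA \<beta>" "ladder_op \<beta> j q p g \<in> HA \<beta>"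
  shows "HA_inner \<beta> (ladder_op \<beta> j p q f) g = HA_inner \<beta> f (ladder_op \<beta> j q p g)"
proof -
  obtain k where jk: "j \<noteq> k" using ex_other by blast
  note ef = HA_entire[OF f(1)] and eg = HA_entire[OF g(1)]
  show ?thesis
    unfolding HA_inner_fock[OF jk entire2_ladder_op[OF ef] eg] HA_inner_fock[OF jk ef entire2_ladder_op[OF eg]]
      fock_ladder_op[OF jk ef] fock_ladder_op[OF jk eg]
    using f g unfolding HA_norm_fock(1)[OF jk ef] HA_norm_fock(1)[OF jk eg]
      HA_norm_fock(1)[OF jk entire2_ladder_op[OF ef]] HA_norm_fock(1)[OF jk entire2_ladder_op[OF eg]]
      fock_ladder_op[OF jk ef] fock_ladder_op[OF jk eg]
    by (intro ladder_fst_adjoint sep_entire_fock jk ef eg)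
qed

lemma HA_ladder_adjoint_unique:
  assumes g: "g \<in> HA \<beta>" and h: "h \<in> HA \<beta>"
    and eq: "\<And>f. f \<in> HA \<beta> \<Longrightarrow> ladder_op \<beta> j p q f \<in> HA \<beta> \<Longrightarrow> HA_inner \<beta> (ladder_op \<beta> j p q f) g = HA_inner \<beta> f h"
  shows "h = ladder_op \<beta> j q p g"
proof
  fix z
  obtain k where jk: "j \<noteq> k" using ex_other by blast
  note eg = HA_entire[OF g] and eh = HA_entire[OF h]
  have "fock \<beta> j k h w v = ladder_fst q p (fock \<beta> j k g) w v" for w v
  proof (rule ladder_fst_adjoint_unique)
    show "sep_entire (fock \<beta> j k g)" "sep_entire (fock \<beta> j k h)"
      by (intro sep_entire_fock jk eg eh)+
    show "sq_int2 (fock \<beta> j k g)" "sq_int2 (fock \<beta> j k h)"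
      using g h unfolding HA_norm_fock(1)[OF jk eg] HA_norm_fock(1)[OF jk eh] .
    fix m n
    \<comment> \<open>The preimage of a monomial under the passage to the Fock space.\<close>
    define f where "f z = (z $ j) ^ m * (z $ k) ^ n * inverse (dress \<beta> z)" for z
    have pw: "entire2 (\<lambda>z. (z $ i) ^ m)" for i and m :: nat
      by (induction m) (auto intro: entire2_const entire2_mult entire2_coord)
    \<comment> \<open>Since the inverse is again a \<open>dress\<close>, with the opposite sign of
      \<open>\<beta>\<close>, the test function is visibly entire.\<close>
    have inv: "inverse (dress \<beta> z) = dress (- \<beta>) z" for z
      unfolding dress_def by (subst exp_minus[symmetric], rule arg_cong[where f = exp]) (simp add: field_simps)
    have ef: "entire2 f"
      unfolding f_def[abs_def] inv by (intro entire2_mult pw entire2_dress)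
    have F: "fock \<beta> j k f = (\<lambda>w v. w ^ m * v ^ n)"
      using jk by (auto simp: fun_eq_iff fock_apply f_def) (simp_all add: axis_def)
    have "f \<in> HA \<beta>"
      unfolding HA_norm_fock(1)[OF jk ef] F by (rule sq_int2_monomial)
    moreover have "ladder_op \<beta> j p q f \<in> HA \<beta>"
      unfolding HA_norm_fock(1)[OF jk entire2_ladder_op[OF ef]] fock_ladder_op[OF jk ef] F
      by (rule sq_int2_ladder_monomial)
    ultimately have "HA_inner \<beta> (ladder_op \<beta> j p q f) g = HA_inner \<beta> f h"
      by (rule eq)
    then show "(LINT (v, w)|(gauss \<Otimes>\<^sub>M gauss). ladder_fst p q (\<lambda>w v. w ^ m * v ^ n) w v * cnj (fock \<beta> j k g w v))
      = (LINT (v, w)|(gauss \<Otimes>\<^sub>M gauss). (w ^ m * v ^ n) * cnj (fock \<beta> j k h w v))"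
      unfolding HA_inner_fock[OF jk entire2_ladder_op[OF ef] eg] HA_inner_fock[OF jk ef eh] fock_ladder_op[OF jk ef] F .
  qed
  then have "fock \<beta> j k h (z $ j) (z $ k) = fock \<beta> j k (ladder_op \<beta> j q p g) (z $ j) (z $ k)"
    by (simp add: fock_ladder_op[OF jk eg])
  then show "h z = ladder_op \<beta> j q p g z"
    unfolding fock_def slice_inverse[OF jk] by simp
qed

section \<open>Maximal ladder operators and their adjoints\<close>

definition max_ladder_op :: "real ^ 2 \<Rightarrow> 2 \<Rightarrow> real \<Rightarrow> real \<Rightarrow> unbounded_op" where
  "max_ladder_op \<beta> j p q f =
     (if f \<in> HA \<beta> \<and> ladder_op \<beta> j p q f \<in> HA \<beta> then Some (ladder_op \<beta> j p q f) else None)"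

lemma dom_max_ladder_op:
  "f \<in> dom (max_ladder_op \<beta> j p q) \<longleftrightarrow> f \<in> HA \<beta> \<and> ladder_op \<beta> j p q f \<in> HA \<beta>"
  by (auto simp: max_ladder_op_def dom_def)

lemma the_max_ladder_op:
  "f \<in> HA \<beta> \<Longrightarrow> ladder_op \<beta> j p q f \<in> HA \<beta> \<Longrightarrow> the (max_ladder_op \<beta> j p q f) = ladder_op \<beta> j p q f"
  by (simp add: max_ladder_op_def)

text \<open>An adjoint value at \<open>g\<close> is forced to be
  \<open>ladder_op \<beta> j q p g\<close>. This settles existence and uniqueness together: the
  description in \<open>adjoint_op\<close> is meaningful without a separate proof that the domain is
  dense.\<close>

theorem adjoint_max_ladder_op:
  "adjoint_op \<beta> (max_ladder_op \<beta> j p q) = max_ladder_op \<beta> j q p"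
proof
  fix g
  have iff: "is_adjoint_value \<beta> (max_ladder_op \<beta> j p q) g h \<longleftrightarrow> h = ladder_op \<beta> j q p g \<and> h \<in> HA \<beta>"
    if g: "g \<in> HA \<beta>" for h
  proof
    assume adj: "is_adjoint_value \<beta> (max_ladder_op \<beta> j p q) g h"
    then have h: "h \<in> HA \<beta>"
      by (simp add: is_adjoint_value_def)
    have "HA_inner \<beta> (ladder_op \<beta> j p q f) g = HA_inner \<beta> f h"
      if f: "f \<in> HA \<beta>" "ladder_op \<beta> j p q f \<in> HA \<beta>" for f
    proof -
      have "f \<in> dom (max_ladder_op \<beta> j p q)"
        unfolding dom_max_ladder_op using f by simp
      with adj have "HA_inner \<beta> (the (max_ladder_op \<beta> j p q f)) g = HA_inner \<beta> f h"
        unfolding is_adjoint_value_def by blast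
      then show ?thesis
        unfolding the_max_ladder_op[OF f] .
    qed
    with h show "h = ladder_op \<beta> j q p g \<and> h \<in> HA \<beta>"
      using HA_ladder_adjoint_unique[OF g h] by blast
  next
    assume h: "h = ladder_op \<beta> j q p g \<and> h \<in> HA \<beta>"
    have Lg: "ladder_op \<beta> j q p g \<in> HA \<beta>"
      using conjunct2[OF h] unfolding conjunct1[OF h] .
    show "is_adjoint_value \<beta> (max_ladder_op \<beta> j p q) g h"
      unfolding is_adjoint_value_def
    proof (intro conjI ballI)
      fix f assume "f \<in> dom (max_ladder_op \<beta> j p q)"
      then have f: "f \<in> HA \<beta>" "ladder_op \<beta> j p q f \<in> HA \<beta>"
        unfolding dom_max_ladder_op by simp_all
      show "HA_inner \<beta> (the (max_ladder_op \<beta> j p q f)) g = HA_inner \<beta> f h"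
        unfolding the_max_ladder_op[OF f] conjunct1[OF h] by (rule HA_ladder_adjoint[OF f g Lg])
    qed (rule conjunct2[OF h])
  qed
  show "adjoint_op \<beta> (max_ladder_op \<beta> j p q) g = max_ladder_op \<beta> j q p g"
  proof (cases "g \<in> HA \<beta> \<and> ladder_op \<beta> j q p g \<in> HA \<beta>")
    case True
    then have "(THE h. is_adjoint_value \<beta> (max_ladder_op \<beta> j p q) g h) = ladder_op \<beta> j q p g"
      by (intro the_equality) (auto simp: iff)
    with True show ?thesis
      by (auto simp: adjoint_op_def max_ladder_op_def iff)
  qed (auto simp: adjoint_op_def max_ladder_op_def iff)
qed

lemma a_op_eq_ladder: "a_op \<beta> j = max_ladder_op \<beta> j 1 (\<beta> $ j)"
proof -
  have "ladder_op \<beta> j 1 (\<beta> $ j) f = partial_deriv j f" for f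
    by (simp add: ladder_op_def fun_eq_iff)
  then show ?thesis
    by (intro ext) (simp add: a_op_def max_ladder_op_def)
qed

lemma b_op_eq_ladder: "b_op \<beta> j = max_ladder_op \<beta> j 0 1"
proof -
  have "ladder_op \<beta> j 0 1 f = (\<lambda>z. z $ j * f z)" for f
    by (simp add: ladder_op_def fun_eq_iff)
  then show ?thesis
    by (intro ext) (simp add: b_op_def max_ladder_op_def)
qed

section \<open>Commutators on entire functions\<close>

lemma partial_deriv_has_derivative:
  assumes "entire2 f"
  shows "((\<lambda>w. f (z + axis i w)) has_field_derivative partial_deriv i f z) (at 0)"
proof -
  obtain k where k: "i \<noteq> k" using ex_other by blast
  have "(\<lambda>w. slice i k f w (z $ k)) holomorphic_on UNIV"
    using assms entire2_slice[OF k] by (intro sep_entireD(1)) auto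
  moreover have "(\<lambda>w. z $ i + w) holomorphic_on UNIV"
    by (intro holomorphic_intros)
  ultimately have "(\<lambda>w. slice i k f (z $ i + w) (z $ k)) holomorphic_on UNIV"
    using holomorphic_on_compose_gen[of "\<lambda>w. z $ i + w" UNIV "\<lambda>w. slice i k f w (z $ k)" UNIV]
    by (simp add: o_def)
  moreover have "slice i k f (z $ i + w) (z $ k) = f (z + axis i w)" for w
  proof -
    have "axis i (z $ i + w) + axis k (z $ k) = (axis i (z $ i) + axis k (z $ k)) + axis i w"
      by (auto simp: vec_eq_iff axis_def)
    then show ?thesis
      unfolding slice_def using vec_decompose[OF k, of z] by simp
  qed
  ultimately have "(\<lambda>w. f (z + axis i w)) holomorphic_on UNIV"
    by simp
  then show ?thesis
    unfolding partial_deriv_def by (rule holomorphic_derivI) auto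
qed

lemma partial_deriv_ladder_op:
  assumes f: "entire2 f"
  shows "partial_deriv i (ladder_op \<beta> j p q f) z
    = of_real p * partial_deriv i (partial_deriv j f) z
      + of_real (q - p * \<beta> $ j) * ((if i = j then f z else 0) + z $ j * partial_deriv i f z)"
proof -
  have zero: "axis i 0 = (0 :: complex ^ 2)"
    by (simp add: axis_def vec_eq_iff)
  have "((\<lambda>w. (z + axis i w) $ j) has_field_derivative (if i = j then 1 else 0)) (at 0)"
    by (auto simp: axis_def intro!: derivative_eq_intros)
  from DERIV_mult[OF this partial_deriv_has_derivative[OF f]]
  have m: "((\<lambda>w. (z + axis i w) $ j * f (z + axis i w)) has_field_derivative
      ((if i = j then f z else 0) + z $ j * partial_deriv i f z)) (at 0)"
    by (rule DERIV_cong) (simp add: zero)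
  have "((\<lambda>w. ladder_op \<beta> j p q f (z + axis i w)) has_field_derivative
      of_real p * partial_deriv i (partial_deriv j f) z
      + of_real (q - p * \<beta> $ j) * ((if i = j then f z else 0) + z $ j * partial_deriv i f z)) (at 0)"
    unfolding ladder_op_def
    by (intro DERIV_add DERIV_cmult partial_deriv_has_derivative entire2_partial_deriv f m)
  then show ?thesis
    unfolding partial_deriv_def[of i "ladder_op \<beta> j p q f"] by (rule DERIV_imp_deriv)
qed

text \<open>From \<open>[D, M] = 1\<close>: with first-order coefficients \<open>p\<close>,
  \<open>q\<close> and multipliers \<open>q - p * \<beta> $ j\<close>,
  \<open>p - q * \<beta> $ j\<close>, the constant is
  \<open>p * (p - q * \<beta> $ j) - q * (q - p * \<beta> $ j)\<close>, in which
  \<open>\<beta>\<close> cancels.\<close>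

lemma ladder_op_commutator:
  assumes "entire2 f"
  shows "ladder_op \<beta> j p q (ladder_op \<beta> j q p f) z - ladder_op \<beta> j q p (ladder_op \<beta> j p q f) z
    = of_real (p\<^sup>2 - q\<^sup>2) * f z"
  unfolding ladder_op_def[of _ _ _ _ "ladder_op _ _ _ _ _"] partial_deriv_ladder_op[OF assms]
  by (simp add: ladder_op_def algebra_simps power2_eq_square)

lemma ladder_op_commute:
  assumes "entire2 f" "j \<noteq> k"
  shows "ladder_op \<beta> j p q (ladder_op \<beta> k r s f) z = ladder_op \<beta> k r s (ladder_op \<beta> j p q f) z"
  unfolding ladder_op_def[of _ _ _ _ "ladder_op _ _ _ _ _"] partial_deriv_ladder_op[OF assms(1)]
  using assms(2) by (simp add: ladder_op_def algebra_simps partial_deriv_commute[OF assms(1), of j k])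

lemma commutator_max_ladder_op:
  assumes "f \<in> dom (commutator (max_ladder_op \<beta> j p q) (max_ladder_op \<beta> k r s))"
  shows "entire2 f"
    and "the (commutator (max_ladder_op \<beta> j p q) (max_ladder_op \<beta> k r s) f)
      = (\<lambda>z. ladder_op \<beta> j p q (ladder_op \<beta> k r s f) z - ladder_op \<beta> k r s (ladder_op \<beta> j p q f) z)"
  using assms
  by (auto simp: commutator_def dom_def map_comp_def max_ladder_op_def HA_entire split: if_splits option.splits)

theorem theorem2p2:
  fixes \<beta> :: "real ^ 2" and j :: 2
  defines "a \<equiv> a_op \<beta>" and "b \<equiv> b_op \<beta>"
    and "a' \<equiv> (\<lambda>i. adjoint_op \<beta> (a_op \<beta> i))" and "b' \<equiv> (\<lambda>i. adjoint_op \<beta> (b_op \<beta> i))"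
  shows
    "(dom (a j) = dom (a' j) \<and>
       (\<forall>f \<in> dom (a j).
          (HA_norm \<beta> (the (a' j f)))\<^sup>2 - (HA_norm \<beta> (the (a j f)))\<^sup>2
            = (1 - (\<beta> $ j)\<^sup>2) * (HA_norm \<beta> f)\<^sup>2)) \<and>
     (dom (b j) = dom (b' j) \<and>
       (\<forall>f \<in> dom (b j).
          (HA_norm \<beta> (the (b j f)))\<^sup>2 - (HA_norm \<beta> (the (b' j f)))\<^sup>2 = (HA_norm \<beta> f)\<^sup>2)) \<and>
     (\<forall>f \<in> dom (a j) \<inter> dom (b j).
        the (a' j f) = (\<lambda>z. complex_of_real (\<beta> $ j) * the (a j f) z
                          + complex_of_real (1 - (\<beta> $ j)\<^sup>2) * the (b j f) z)) \<and>
     (commutator_eq_scalar (a j) (a' j) (complex_of_real (1 - (\<beta> $ j)\<^sup>2)) \<and>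
       (\<forall>k. commutator_eq_scalar (a j) (a k) 0 \<and> commutator_eq_scalar (a' j) (a' k) 0)) \<and>
     ((\<beta> $ j)\<^sup>2 \<noteq> 1 \<longrightarrow>
       (\<forall>f \<in> dom (a j).
          (HA_norm \<beta> f)\<^sup>2
            \<le> 1 / \<bar>1 - (\<beta> $ j)\<^sup>2\<bar> * ((HA_norm \<beta> (the (a' j f)))\<^sup>2 + (HA_norm \<beta> (the (a j f)))\<^sup>2)))"
proof -
  have a: "a i = max_ladder_op \<beta> i 1 (\<beta> $ i)" and b: "b i = max_ladder_op \<beta> i 0 1" for i
    unfolding a_def b_def by (rule a_op_eq_ladder b_op_eq_ladder)+
  \<comment> \<open>Swapping the parameters makes the adjoint of \<open>a i\<close> act as the
    derivative times \<open>\<beta> $ i\<close> plus the coordinate times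
    \<open>1 - (\<beta> $ i)\<^sup>2\<close>, which is the formula in (3).\<close>
  have a': "a' i = max_ladder_op \<beta> i (\<beta> $ i) 1" and b': "b' i = max_ladder_op \<beta> i 1 0" for i
    unfolding a'_def b'_def a_op_eq_ladder b_op_eq_ladder adjoint_max_ladder_op by (rule refl)+
  have val: "the (max_ladder_op \<beta> j p q f) = ladder_op \<beta> j p q f" if "f \<in> dom (max_ladder_op \<beta> j p q)" for f j p q
    using that unfolding dom_max_ladder_op by (simp add: the_max_ladder_op)
  have dom_swap: "dom (max_ladder_op \<beta> j p q) = dom (max_ladder_op \<beta> j q p)" for j p q
    unfolding set_eq_iff dom_max_ladder_op using HA_ladder_swap(1) by blast
  have norm: "(HA_norm \<beta> (the (max_ladder_op \<beta> j q p f)))\<^sup>2 + q\<^sup>2 * (HA_norm \<beta> f)\<^sup>2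
      = (HA_norm \<beta> (the (max_ladder_op \<beta> j p q f)))\<^sup>2 + p\<^sup>2 * (HA_norm \<beta> f)\<^sup>2"
    if "f \<in> dom (max_ladder_op \<beta> j p q)" for f j p q
  proof -
    have "f \<in> dom (max_ladder_op \<beta> j q p)"
      using that unfolding dom_swap[of j p q] .
    from val[OF this] val[OF that] show ?thesis
      using HA_ladder_swap(2)[of f \<beta> j p q] that unfolding dom_max_ladder_op by simp
  qed
  have n1: "(HA_norm \<beta> (the (a' j f)))\<^sup>2 - (HA_norm \<beta> (the (a j f)))\<^sup>2 = (1 - (\<beta> $ j)\<^sup>2) * (HA_norm \<beta> f)\<^sup>2"
    if "f \<in> dom (a j)" for f
    using norm[OF that[unfolded a]] unfolding a a' by (simp add: algebra_simps)
  have n2: "(HA_norm \<beta> (the (b j f)))\<^sup>2 - (HA_norm \<beta> (the (b' j f)))\<^sup>2 = (HA_norm \<beta> f)\<^sup>2"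
    if "f \<in> dom (b j)" for f
    using norm[OF that[unfolded b]] unfolding b b' by simp
  have s3: "the (a' j f) = (\<lambda>z. complex_of_real (\<beta> $ j) * the (a j f) z
                          + complex_of_real (1 - (\<beta> $ j)\<^sup>2) * the (b j f) z)"
    if "f \<in> dom (a j) \<inter> dom (b j)" for f
  proof -
    have "f \<in> dom (max_ladder_op \<beta> j 1 (\<beta> $ j))" "f \<in> dom (max_ladder_op \<beta> j (\<beta> $ j) 1)" "f \<in> dom (max_ladder_op \<beta> j 0 1)"
      using that dom_swap[of j 1 "\<beta> $ j"] unfolding a b by blast+
    then show ?thesis
      unfolding a a' b by (simp add: val ladder_op_def fun_eq_iff power2_eq_square algebra_simps del: domIff)
  qed
  have c1: "commutator_eq_scalar (a j) (a' j) (complex_of_real (1 - (\<beta> $ j)\<^sup>2))"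
    unfolding commutator_eq_scalar_def a a'
  proof
    fix f assume f: "f \<in> dom (commutator (max_ladder_op \<beta> j 1 (\<beta> $ j)) (max_ladder_op \<beta> j (\<beta> $ j) 1))"
    show "the (commutator (max_ladder_op \<beta> j 1 (\<beta> $ j)) (max_ladder_op \<beta> j (\<beta> $ j) 1) f)
        = (\<lambda>z. complex_of_real (1 - (\<beta> $ j)\<^sup>2) * f z)"
      unfolding commutator_max_ladder_op(2)[OF f] ladder_op_commutator[OF commutator_max_ladder_op(1)[OF f]] by simp
  qed
  \<comment> \<open>The parameters are functions of the index: they may differ between two
    coordinates, as the entries of \<open>\<beta>\<close> do, but for \<open>j = k\<close> both
    operators coincide and the commutator vanishes trivially.\<close>
  have c2: "commutator_eq_scalar (max_ladder_op \<beta> j (p j) (q j)) (max_ladder_op \<beta> k (p k) (q k)) 0" for k p q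
    unfolding commutator_eq_scalar_def
  proof
    fix f assume f: "f \<in> dom (commutator (max_ladder_op \<beta> j (p j) (q j)) (max_ladder_op \<beta> k (p k) (q k)))"
    show "the (commutator (max_ladder_op \<beta> j (p j) (q j)) (max_ladder_op \<beta> k (p k) (q k)) f) = (\<lambda>z. 0 * f z)"
      unfolding commutator_max_ladder_op(2)[OF f]
      using ladder_op_commute[OF commutator_max_ladder_op(1)[OF f], of j k] by (cases "j = k") simp_all
  qed
  have s5: "(HA_norm \<beta> f)\<^sup>2
            \<le> 1 / \<bar>1 - (\<beta> $ j)\<^sup>2\<bar> * ((HA_norm \<beta> (the (a' j f)))\<^sup>2 + (HA_norm \<beta> (the (a j f)))\<^sup>2)"
    if "(\<beta> $ j)\<^sup>2 \<noteq> 1" "f \<in> dom (a j)" for f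
  proof -
    \<comment> \<open>Absolute values in the norm identity of (1) cover both signs of
      \<open>1 - (\<beta> $ j)\<^sup>2\<close>; a difference of nonnegative numbers is at most their
      sum in modulus.\<close>
    have "\<bar>1 - (\<beta> $ j)\<^sup>2\<bar> * (HA_norm \<beta> f)\<^sup>2 = \<bar>(1 - (\<beta> $ j)\<^sup>2) * (HA_norm \<beta> f)\<^sup>2\<bar>"
      by (simp add: abs_mult)
    also have "\<dots> = \<bar>(HA_norm \<beta> (the (a' j f)))\<^sup>2 - (HA_norm \<beta> (the (a j f)))\<^sup>2\<bar>"
      unfolding n1[OF that(2)] ..
    also have "\<dots> \<le> (HA_norm \<beta> (the (a' j f)))\<^sup>2 + (HA_norm \<beta> (the (a j f)))\<^sup>2"
      using zero_le_power2[of "HA_norm \<beta> (the (a' j f))"] zero_le_power2[of "HA_norm \<beta> (the (a j f))"] by linarith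
    finally show ?thesis
      using that(1) by (simp add: field_simps)
  qed
  show ?thesis
    using n1 n2 s3 s5 c1 c2[of "\<lambda>_. 1" "\<lambda>i. \<beta> $ i"] c2[of "\<lambda>i. \<beta> $ i" "\<lambda>_. 1"]
      dom_swap[of j 1 "\<beta> $ j"] dom_swap[of j 0 1]
    unfolding a[symmetric] b[symmetric] a'[symmetric] b'[symmetric] by blast
qed

end
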